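(* Let $A$ and $A^*$ be the infinitesimal generators of the $C_0$-semigroups $(T(t))_{t \ge 0}$ on $C$ and $(T^*(t))_{t \ge 0}$ on $C^*$, respectively, with domains $\mathcal{D}(A)$ and $\mathcal{D}(A^* )$. Then $$B(\psi, A\phi) = B(A^*\psi, \phi)$$ holds for all $\phi \in \mathcal{D}(A)$ and $\psi \in \mathcal{D}(A^* )$.
   Context: Let $r>0$ and let $n$ be a positive integer. $\mathbb{C}^n$ denotes column vectors, $(\mathbb{C}^n)'$ denotes $n$-dimensional complex row vectors, $M_n(\mathbb{C})$ the $n\times n$ complex matrices. Let $\eta=(\eta_{ij})\colon [-r,0]\to M_n(\mathbb{C})$ be a function of bounded variation. Integrals against $d\eta$ are Riemann–Stieltjes integrals taken componentwise: for continuous $\phi$ (column valued) and $\psi$ (row valued), $\left(\int d\eta(\theta)\,\phi(\theta)\right)_i=\sum_j\int \phi_j(\theta)\,d\eta_{ij}(\theta)$ and $\left(\int \psi(\theta)\,d\eta(\theta)\right)_j=\sum_i\int \psi_i(\theta)\,d\eta_{ij}(\theta)$. Write $C=C([-r,0],\mathbb{C}^n)$ and $C^*=C([0,r],(\mathbb{C}^n)')$ (supremum norms). Define the continuous linear maps $L\colon C\to\mathbb{C}^n$, $L\phi=\int_{-r}^0 d\eta(\theta)\,\phi(\theta)$, and $L^*\colon C^*\to(\mathbb{C}^n)'$, $L^*\psi=\int_{-r}^0\psi(-\theta)\,d\eta(\theta)$. The bilinear form $B\colon C^*\times C\to\mathbb{C}$ is $$B(\psi,\phi)=\psi(0)\phi(0)+\int_{-r}^0\left(\int_{-r}^{\xi}\psi(\xi-\theta)\,d\eta(\theta)\right)\phi(\xi)\,d\xi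 ,$$ where the inner integral, as a function of $\xi\in[-r,0]$, is Riemann integrable. For $\phi\in C$, $x(\cdot;\phi)\colon[-r,\infty)\to\mathbb{C}^n$ is the unique continuous solution (known to exist) of $\dot x(t)=Lx_t$ $(t\ge0)$, $x_0=\phi$, where $x_t\in C$, $x_t(\theta)=x(t+\theta)$ for $\theta\in[-r,0]$. For $\psi\in C^*$, $y(\cdot;\psi)\colon(-\infty,r]\to(\mathbb{C}^n)'$ is the unique continuous solution (known to exist) of $\dot y(t)=-L^*y^t$ $(t\le0)$, $y^0=\psi$, where $y^t\in C^*$, $y^t(\tau)=y(t+\tau)$ for $\tau\in[0,r]$. (Derivatives at $t=0$ are one-sided.) For $t\ge0$ set $T(t)\phi=x(\cdot;\phi)_t$ and $T^*(t)\psi=y(\cdot;\psi)^{-t}$; $(T(t))_{t\ge0}$ and $(T^*(t))_{t\ge0}$ are $C_0$-semigroups on $C$ and $C^*$, respectively. Note that $A^*$ is just notation for the generator of $(T^*(t))_{t\ge 0}$, not a functional-analytic adjoint. *)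

theory Defs
  imports "HOL-Analysis.Analysis"
begin

section \<open>Functions of bounded variation and the Riemann--Stieltjes integral\<close>

definition bounded_variation_on :: "real \<Rightarrow> real \<Rightarrow> (real \<Rightarrow> 'a::real_normed_vector) \<Rightarrow> bool" where
  "bounded_variation_on a b g \<longleftrightarrow>
     (\<exists>M. \<forall>D. D division_of {a..b} \<longrightarrow> (\<Sum>K\<in>D. norm (g (Sup K) - g (Inf K))) \<le> M)"

text \<open>
  The limit is taken as the mesh tends to zero, with a uniform bound on the length of the
  subintervals (and not a gauge, which would give the Henstock--Stieltjes integral).
  Degenerate subintervals contribute nothing to the sums.
\<close>

definition has_rs_integral ::
    "real \<Rightarrow> real \<Rightarrow> (real \<Rightarrow> complex) \<Rightarrow> (real \<Rightarrow> complex) \<Rightarrow> complex \<Rightarrow> bool" where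
  "has_rs_integral a b f g I \<longleftrightarrow>
     (\<forall>e>0. \<exists>d>0. \<forall>p. p tagged_division_of {a..b} \<and> (\<forall>(x, K)\<in>p. Sup K - Inf K < d) \<longrightarrow>
        norm ((\<Sum>(x, K)\<in>p. f x * (g (Sup K) - g (Inf K))) - I) < e)"

definition rs_integral ::
    "real \<Rightarrow> real \<Rightarrow> (real \<Rightarrow> complex) \<Rightarrow> (real \<Rightarrow> complex) \<Rightarrow> complex" where
  "rs_integral a b f g = (THE I. has_rs_integral a b f g I)"

text \<open>
  Row and column vectors are both represented by the type \<open>complex ^ 'n\<close>; \<open>rs_integral_col\<close> is
  \<open>\<integral> d\<eta>(\<theta>) \<phi>(\<theta>)\<close> (a column) and \<open>rs_integral_row\<close> is \<open>\<integral> \<psi>(\<theta>) d\<eta>(\<theta>)\<close> (a row), both over \<open>[a, b]\<close>.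
\<close>

definition rs_integral_col ::
    "real \<Rightarrow> real \<Rightarrow> (real \<Rightarrow> complex ^ 'n ^ 'n) \<Rightarrow> (real \<Rightarrow> complex ^ 'n) \<Rightarrow> complex ^ 'n" where
  "rs_integral_col a b \<eta> \<phi> =
     (\<chi> i. \<Sum>j\<in>UNIV. rs_integral a b (\<lambda>\<theta>. \<phi> \<theta> $ j) (\<lambda>\<theta>. \<eta> \<theta> $ i $ j))"

definition rs_integral_row ::
    "real \<Rightarrow> real \<Rightarrow> (real \<Rightarrow> complex ^ 'n) \<Rightarrow> (real \<Rightarrow> complex ^ 'n ^ 'n) \<Rightarrow> complex ^ 'n" where
  "rs_integral_row a b \<psi> \<eta> =
     (\<chi> j. \<Sum>i\<in>UNIV. rs_integral a b (\<lambda>\<theta>. \<psi> \<theta> $ i) (\<lambda>\<theta>. \<eta> \<theta> $ i $ j))"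

text \<open>The product of a row with a column: bilinear, without complex conjugation.\<close>

definition row_times_col :: "complex ^ 'n \<Rightarrow> complex ^ 'n \<Rightarrow> complex" where
  "row_times_col u v = (\<Sum>i\<in>UNIV. u $ i * v $ i)"

section \<open>The delay equation, its formal adjoint and the bilinear form\<close>

text \<open>
  Elements of \<open>C([-r, 0], \<complex>\<^sup>n)\<close> and \<open>C([0, r], (\<complex>\<^sup>n)')\<close> are functions on all of \<open>real\<close> that are
  continuous on the interval; nothing below depends on their values outside of it.
\<close>

definition fde_op :: "real \<Rightarrow> (real \<Rightarrow> complex ^ 'n ^ 'n) \<Rightarrow> (real \<Rightarrow> complex ^ 'n) \<Rightarrow> complex ^ 'n" where
  "fde_op r \<eta> \<phi> = rs_integral_col (- r) 0 \<eta> \<phi>"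

definition adj_fde_op :: "real \<Rightarrow> (real \<Rightarrow> complex ^ 'n ^ 'n) \<Rightarrow> (real \<Rightarrow> complex ^ 'n) \<Rightarrow> complex ^ 'n" where
  "adj_fde_op r \<eta> \<psi> = rs_integral_row (- r) 0 (\<lambda>\<theta>. \<psi> (- \<theta>)) \<eta>"

definition bilin_form ::
    "real \<Rightarrow> (real \<Rightarrow> complex ^ 'n ^ 'n) \<Rightarrow> (real \<Rightarrow> complex ^ 'n) \<Rightarrow> (real \<Rightarrow> complex ^ 'n) \<Rightarrow> complex" where
  "bilin_form r \<eta> \<psi> \<phi> =
     row_times_col (\<psi> 0) (\<phi> 0) +
     integral {- r..0}
       (\<lambda>\<xi>. row_times_col (rs_integral_row (- r) \<xi> (\<lambda>\<theta>. \<psi> (\<xi> - \<theta>)) \<eta>) (\<phi> \<xi>))"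

definition segment :: "(real \<Rightarrow> 'a) \<Rightarrow> real \<Rightarrow> real \<Rightarrow> 'a" where
  "segment x t = (\<lambda>\<theta>. x (t + \<theta>))"

definition solves_fde ::
    "real \<Rightarrow> (real \<Rightarrow> complex ^ 'n ^ 'n) \<Rightarrow> (real \<Rightarrow> complex ^ 'n) \<Rightarrow> (real \<Rightarrow> complex ^ 'n) \<Rightarrow> bool" where
  "solves_fde r \<eta> \<phi> x \<longleftrightarrow>
     continuous_on {- r..} x \<and>
     (\<forall>\<theta>\<in>{- r..0}. x \<theta> = \<phi> \<theta>) \<and>
     (\<forall>t\<ge>0. (x has_vector_derivative fde_op r \<eta> (segment x t)) (at t within {0..}))"

definition solves_adj_fde ::
    "real \<Rightarrow> (real \<Rightarrow> complex ^ 'n ^ 'n) \<Rightarrow> (real \<Rightarrow> complex ^ 'n) \<Rightarrow> (real \<Rightarrow> complex ^ 'n) \<Rightarrow> bool" where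
  "solves_adj_fde r \<eta> \<psi> y \<longleftrightarrow>
     continuous_on {..r} y \<and>
     (\<forall>\<tau>\<in>{0..r}. y \<tau> = \<psi> \<tau>) \<and>
     (\<forall>t\<le>0. (y has_vector_derivative - adj_fde_op r \<eta> (segment y t)) (at t within {..0}))"

text \<open>
  The solutions are unique on \<open>[-r, \<infinity>)\<close> and \<open>(-\<infinity>, r]\<close> respectively, but as total functions they are
  arbitrary elsewhere; hence \<open>SOME\<close> and not \<open>THE\<close>.
\<close>

definition sol_fde ::
    "real \<Rightarrow> (real \<Rightarrow> complex ^ 'n ^ 'n) \<Rightarrow> (real \<Rightarrow> complex ^ 'n) \<Rightarrow> real \<Rightarrow> complex ^ 'n" where
  "sol_fde r \<eta> \<phi> = (SOME x. solves_fde r \<eta> \<phi> x)"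

definition sol_adj_fde ::
    "real \<Rightarrow> (real \<Rightarrow> complex ^ 'n ^ 'n) \<Rightarrow> (real \<Rightarrow> complex ^ 'n) \<Rightarrow> real \<Rightarrow> complex ^ 'n" where
  "sol_adj_fde r \<eta> \<psi> = (SOME y. solves_adj_fde r \<eta> \<psi> y)"

definition semigroup_T ::
    "real \<Rightarrow> (real \<Rightarrow> complex ^ 'n ^ 'n) \<Rightarrow> real \<Rightarrow> (real \<Rightarrow> complex ^ 'n) \<Rightarrow> real \<Rightarrow> complex ^ 'n" where
  "semigroup_T r \<eta> t \<phi> = segment (sol_fde r \<eta> \<phi>) t"

definition semigroup_Tstar ::
    "real \<Rightarrow> (real \<Rightarrow> complex ^ 'n ^ 'n) \<Rightarrow> real \<Rightarrow> (real \<Rightarrow> complex ^ 'n) \<Rightarrow> real \<Rightarrow> complex ^ 'n" where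
  "semigroup_Tstar r \<eta> t \<psi> = segment (sol_adj_fde r \<eta> \<psi>) (- t)"

section \<open>Infinitesimal generators on spaces of continuous functions\<close>

text \<open>
  For an operator family \<open>T\<close> on \<open>C(S)\<close> with the supremum norm, convergence of the difference
  quotients in norm is uniform convergence on \<open>S\<close>. The value of \<open>generator\<close> is determined on \<open>S\<close> only.
\<close>

definition has_generator_value ::
    "real set \<Rightarrow> (real \<Rightarrow> (real \<Rightarrow> 'a::real_normed_vector) \<Rightarrow> real \<Rightarrow> 'a) \<Rightarrow>
     (real \<Rightarrow> 'a) \<Rightarrow> (real \<Rightarrow> 'a) \<Rightarrow> bool" where
  "has_generator_value S T \<phi> \<zeta> \<longleftrightarrow>
     continuous_on S \<phi> \<and> continuous_on S \<zeta> \<and>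
     uniform_limit S (\<lambda>h \<theta>. (T h \<phi> \<theta> - \<phi> \<theta>) /\<^sub>R h) \<zeta> (at_right 0)"

definition generator_domain ::
    "real set \<Rightarrow> (real \<Rightarrow> (real \<Rightarrow> 'a::real_normed_vector) \<Rightarrow> real \<Rightarrow> 'a) \<Rightarrow> (real \<Rightarrow> 'a) set" where
  "generator_domain S T = {\<phi>. \<exists>\<zeta>. has_generator_value S T \<phi> \<zeta>}"

definition generator ::
    "real set \<Rightarrow> (real \<Rightarrow> (real \<Rightarrow> 'a::real_normed_vector) \<Rightarrow> real \<Rightarrow> 'a) \<Rightarrow> (real \<Rightarrow> 'a) \<Rightarrow> real \<Rightarrow> 'a" where
  "generator S T \<phi> = (SOME \<zeta>. has_generator_value S T \<phi> \<zeta>)"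

end

theory Submission
  imports Defs
begin

text \<open>
  The values of the generators are explicit: for \<open>\<phi>\<close> in the domain of \<open>A\<close>, the uniform limit of the
  difference quotients of \<open>x(\<cdot>; \<phi>)\<close> forces \<open>\<phi>\<close> to be continuously differentiable with \<open>A\<phi> = \<phi>'\<close>, and
  at \<open>\<theta> = 0\<close>, where the quotients follow the equation, \<open>\<phi>'(0) = L\<phi>\<close> (\<open>generator_fde\<close>). In the same
  way \<open>A\<^sup>*\<psi> = -\<psi>'\<close> and \<open>-\<psi>'(0) = L\<^sup>*\<psi>\<close> (\<open>generator_adj_fde\<close>). With these values the claim
  \<open>B(\<psi>, \<phi>') = B(-\<psi>', \<phi>)\<close> becomes an integration by parts. Exchanging the order of integration over
  the triangle \<open>-r \<le> \<theta> \<le> \<xi> \<le> 0\<close>,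
  \<open>\<integral>\<^sub>\<xi> \<integral>\<^sub>\<theta> (\<psi>(\<xi> - \<theta>) d\<eta>(\<theta>) \<phi>'(\<xi>) + \<psi>'(\<xi> - \<theta>) d\<eta>(\<theta>) \<phi>(\<xi>)) d\<xi>\<close> has for fixed \<open>\<theta>\<close> the integrand
  \<open>d/d\<xi> (\<psi>(\<xi> - \<theta>) d\<eta>(\<theta>) \<phi>(\<xi>))\<close>, whose integral over \<open>[\<theta>, 0]\<close> is
  \<open>\<psi>(-\<theta>) d\<eta>(\<theta>) \<phi>(0) - \<psi>(0) d\<eta>(\<theta>) \<phi>(\<theta>)\<close>; integrating over \<open>\<theta>\<close> leaves \<open>(L\<^sup>*\<psi>) \<phi>(0) - \<psi>(0) (L\<phi>)\<close>
  (\<open>rs_convolution_by_parts\<close>). The terms outside the integrals differ by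
  \<open>\<psi>(0) (A\<phi>)(0) - (A\<^sup>*\<psi>)(0) \<phi>(0) = \<psi>(0) (L\<phi>) - (L\<^sup>*\<psi>) \<phi>(0)\<close>, so everything cancels.

  Three ingredients carry this. The Riemann--Stieltjes integral of a continuous function against a
  function of bounded variation exists, with an error bound for its sums that is uniform in the
  upper limit (\<open>rs_sum_rs_integral_close\<close>). This uniformity gives the exchange of the integrals
  (\<open>rs_fubini_triangle\<close>): the inner integral is a uniform limit of finite sums for which the exchange is
  elementary up to an error that vanishes with the mesh. Finally, the delay equation has to be solved
  (\<open>solves_fde_exists\<close>), because only then does the choice in \<open>sol_fde\<close> pick a solution.
\<close>

section \<open>Functions of bounded variation\<close>

text \<open>
  Bounded variation enters every estimate through a real function whose increments dominate those of
  \<open>g\<close>, such as the variation of \<open>g\<close> on \<open>[a, t]\<close>. Increments of the majorant telescope over a division, and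
  one majorant of a matrix-valued function serves all of its entries.
\<close>
definition variation_majorant ::
    "real \<Rightarrow> real \<Rightarrow> (real \<Rightarrow> 'a::real_normed_vector) \<Rightarrow> (real \<Rightarrow> real) \<Rightarrow> bool" where
  "variation_majorant a b g v \<longleftrightarrow>
     (\<forall>c d. a \<le> c \<and> c \<le> d \<and> d \<le> b \<longrightarrow> norm (g d - g c) \<le> v d - v c)"

lemma variation_majorantD:
  "\<lbrakk>variation_majorant a b g v; a \<le> c; c \<le> d; d \<le> b\<rbrakk> \<Longrightarrow> norm (g d - g c) \<le> v d - v c"
  by (simp add: variation_majorant_def)

lemma variation_majorant_mono:
  assumes "variation_majorant a b g v" "a \<le> c" "c \<le> d" "d \<le> b"
  shows "v c \<le> v d"
  using variation_majorantD[OF assms] norm_ge_zero[of "g d - g c"] by linarith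

lemma variation_majorant_mono_on: "variation_majorant a b g v \<Longrightarrow> mono_on {a..b} v"
  by (rule mono_onI) (auto elim: variation_majorant_mono)

lemma variation_majorant_subinterval:
  "\<lbrakk>variation_majorant a b g v; t \<le> b\<rbrakk> \<Longrightarrow> variation_majorant a t g v"
  by (auto simp: variation_majorant_def)

lemma variation_majorant_clamp:
  fixes c d :: real
  assumes "variation_majorant a b g v" "a \<le> c" "c \<le> d" "d \<le> b"
  shows "variation_majorant a' b' (\<lambda>t. g (max c (min d t))) (\<lambda>t. v (max c (min d t)))"
  unfolding variation_majorant_def
proof (intro allI impI)
  fix s t :: real assume "a' \<le> s \<and> s \<le> t \<and> t \<le> b'"
  then have "max c (min d s) \<le> max c (min d t)" by auto
  then show "norm (g (max c (min d t)) - g (max c (min d s))) \<le> v (max c (min d t)) - v (max c (min d s))"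
    using assms(2-) by (intro variation_majorantD[OF assms(1)]) auto
qed

text \<open>
  If \<open>c = d\<close>, the interval to be appended contributes nothing, and \<open>D\<close> itself is the division sought.
\<close>
lemma division_append_interval:
  fixes g :: "real \<Rightarrow> 'a::real_normed_vector"
  assumes D: "D division_of {a..c}" and "a \<le> c" "c \<le> d"
  obtains D' where "D' division_of {a..d}"
    "(\<Sum>K\<in>D'. norm (g (Sup K) - g (Inf K))) =
     (\<Sum>K\<in>D. norm (g (Sup K) - g (Inf K))) + norm (g d - g c)"
proof (cases "c = d")
  case True
  with D that show ?thesis by auto
next
  case False
  with assms have cd: "c < d" by simp
  have "insert {c..d} D = D \<union> {{c..d}}" by simp
  also have "\<dots> division_of {a..c} \<union> {c..d}"
    by (rule division_disjoint_union[OF D])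
       (use cd division_of_self[of c d] in \<open>auto simp: interior_atLeastAtMost_real\<close>)
  also have "{a..c} \<union> {c..d} = {a..d}"
    using assms by auto
  finally have div: "insert {c..d} D division_of {a..d}" .
  have "{c..d} \<notin> D"
  proof
    assume "{c..d} \<in> D"
    then have "{c..d} \<subseteq> {a..c}" using D by blast
    with cd show False by auto
  qed
  with D cd show ?thesis
    by (intro that[OF div]) (simp add: division_of_finite[OF D])
qed

text \<open>
  The majorant is the variation of \<open>g\<close> on \<open>[a, t]\<close> as a function of \<open>t\<close>: appending \<open>[c, d]\<close> to a division
  of \<open>[a, c]\<close> shows that it grows by at least the norm of the increment of \<open>g\<close>.
\<close>
lemma bounded_variation_imp_majorant:
  fixes g :: "real \<Rightarrow> 'a::real_normed_vector"
  assumes "bounded_variation_on a b g"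
  obtains v where "variation_majorant a b g v"
proof -
  define S where "S D = (\<Sum>K\<in>D. norm (g (Sup K) - g (Inf K)))" for D
  obtain M where M: "\<And>D. D division_of {a..b} \<Longrightarrow> S D \<le> M"
    using assms unfolding bounded_variation_on_def S_def by blast
  define v where "v t = Sup (S ` {D. D division_of {a..t}})" for t
  have bdd: "bdd_above (S ` {D. D division_of {a..t}})" if "a \<le> t" "t \<le> b" for t
  proof (rule bdd_aboveI2[of _ _ M], clarify)
    fix D assume D: "D division_of {a..t}"
    obtain D' where "D' division_of {a..b}" "S D' = S D + norm (g b - g t)"
      by (rule division_append_interval[OF D \<open>a \<le> t\<close> \<open>t \<le> b\<close>, of g]) (simp add: S_def)
    with M[of D'] show "S D \<le> M"
      using norm_ge_zero[of "g b - g t"] by linarith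
  qed
  have "norm (g d - g c) \<le> v d - v c" if "a \<le> c" "c \<le> d" "d \<le> b" for c d
  proof -
    have "v c \<le> v d - norm (g d - g c)"
      unfolding v_def[of c]
    proof (rule cSup_least)
      have "{{a..c}} division_of {a..c}"
        using \<open>a \<le> c\<close> division_of_self[of a c] by simp
      then show "S ` {D. D division_of {a..c}} \<noteq> {}" by auto
      fix s assume "s \<in> S ` {D. D division_of {a..c}}"
      then obtain D where D: "D division_of {a..c}" "s = S D" by auto
      obtain D' where D': "D' division_of {a..d}" "S D' = S D + norm (g d - g c)"
        by (rule division_append_interval[OF D(1) \<open>a \<le> c\<close> \<open>c \<le> d\<close>, of g]) (simp add: S_def)
      have "S D' \<le> v d"
        unfolding v_def by (rule cSup_upper[OF imageI bdd]) (use D'(1) that in auto)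
      with D' D show "s \<le> v d - norm (g d - g c)" by simp
    qed
    then show ?thesis by simp
  qed
  then show ?thesis
    by (intro that[of v]) (auto simp: variation_majorant_def)
qed

lemma variation_majorant_entry:
  fixes g :: "real \<Rightarrow> complex ^ 'n ^ 'm"
  assumes "variation_majorant a b g v"
  shows "variation_majorant a b (\<lambda>t. g t $ i $ j) v"
proof -
  have "norm (g d $ i $ j - g c $ i $ j) \<le> norm (g d - g c)" for c d
    using order_trans[OF Finite_Cartesian_Product.norm_nth_le[of "(g d - g c) $ i" j]
        Finite_Cartesian_Product.norm_nth_le[of "g d - g c" i]] by simp
  then show ?thesis
    using assms unfolding variation_majorant_def by (meson order_trans)
qed

text \<open>
  The value 0 on the empty set lets the increments over \<open>K \<inter> J\<close> be summed over all pairs of cells of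
  two divisions, whether or not the cells meet.
\<close>
definition increment :: "(real \<Rightarrow> 'a::real_normed_vector) \<Rightarrow> real set \<Rightarrow> 'a" where
  "increment g K = (if K = {} then 0 else g (Sup K) - g (Inf K))"

text \<open>
  Intersecting with \<open>[c, d]\<close> amounts to clamping the argument of \<open>g\<close> to \<open>[c, d]\<close>. If the intersection is
  empty, both end points are clamped to the same point.
\<close>
lemma increment_Int_clamp:
  fixes c d u w :: real
  assumes "c \<le> d" "u \<le> w"
  shows "increment g ({c..d} \<inter> {u..w}) = g (max c (min d w)) - g (max c (min d u))"
proof (cases "max c u \<le> min d w")
  case True
  then have "increment g ({c..d} \<inter> {u..w}) = g (min d w) - g (max c u)"
    by (auto simp: increment_def)
  moreover have "max c (min d w) = min d w" "max c (min d u) = max c u"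
    using True assms by auto
  ultimately show ?thesis by metis
next
  case False
  then have "{c..d} \<inter> {u..w} = {}" by auto
  moreover have "max c (min d w) = max c (min d u)"
    using False assms by auto
  ultimately show ?thesis
    by (simp add: increment_def)
qed

lemma tagged_division_intervalE:
  fixes a b :: real
  assumes "p tagged_division_of {a..b}" "(x, K) \<in> p"
  obtains c d where "K = {c..d}" "a \<le> c" "c \<le> x" "x \<le> d" "d \<le> b"
proof -
  obtain c d where K: "K = {c..d}"
    using tagged_division_ofD(4)[OF assms] by auto
  moreover have "x \<in> K" "K \<subseteq> {a..b}"
    using assms by blast+
  ultimately show ?thesis
    using that[of c d] by auto
qed

text \<open>
  By the clamping identity this is the telescoping sum of the clamped function. No common
  refinement of the two divisions has to be constructed.
\<close>
lemma increment_tagged_division: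
  fixes a b c d :: real
  assumes "a \<le> b" "q tagged_division_of {a..b}"
  shows "(\<Sum>(y, J)\<in>q. increment g ({c..d} \<inter> J)) = increment g ({c..d} \<inter> {a..b})"
proof (cases "c \<le> d")
  case True
  have "(\<Sum>(y, J)\<in>q. increment g ({c..d} \<inter> J)) =
        (\<Sum>(y, J)\<in>q. g (max c (min d (Sup J))) - g (max c (min d (Inf J))))"
  proof (intro sum.cong refl, clarify)
    fix y J assume "(y, J) \<in> q"
    then obtain u w where "J = {u..w}" "u \<le> w"
      using tagged_division_intervalE[OF assms(2)] by (metis order_trans)
    then show "increment g ({c..d} \<inter> J) = g (max c (min d (Sup J))) - g (max c (min d (Inf J)))"
      using increment_Int_clamp[OF True, of u w g] by simp
  qed
  also have "\<dots> = g (max c (min d b)) - g (max c (min d a))"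
    by (rule additive_tagged_division_1[OF assms])
  finally show ?thesis
    using increment_Int_clamp[OF True assms(1), of g] by simp
qed (simp add: increment_def)

lemma norm_increment_le:
  assumes "variation_majorant a b g v" "{c..d} \<inter> {u..w} \<subseteq> {a..b}" "c \<le> d" "u \<le> w"
  shows "norm (increment g ({c..d} \<inter> {u..w})) \<le> increment v ({c..d} \<inter> {u..w})"
proof (cases "max c u \<le> min d w")
  case True
  then have "max c u \<in> {c..d} \<inter> {u..w}" "min d w \<in> {c..d} \<inter> {u..w}" by auto
  then have "a \<le> max c u" "min d w \<le> b"
    using assms(2) by auto
  with True show ?thesis
    using variation_majorantD[OF assms(1)] by (auto simp: increment_def)
qed (auto simp: increment_def)

section \<open>The Riemann--Stieltjes integral of a continuous function\<close>

text \<open>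
  Both sums are written as double sums over the pairs \<open>K \<inter> J\<close>, that is, over the common refinement of
  \<open>p\<close> and \<open>q\<close>; they then differ only in the tag used. The division \<open>p\<close> of the whole interval is cut off
  at \<open>t\<close>, so that a single \<open>p\<close> approximates the integrals over all \<open>[a, t]\<close> at once.
\<close>
lemma rs_sums_close:
  fixes f g :: "real \<Rightarrow> complex"
  assumes v: "variation_majorant a b g v" and "a \<le> t" "t \<le> b"
    and p: "p tagged_division_of {a..b}" and q: "q tagged_division_of {a..t}"
    and close: "\<And>x K y J. \<lbrakk>(x, K) \<in> p; (y, J) \<in> q; K \<inter> J \<noteq> {}\<rbrakk> \<Longrightarrow> norm (f x - f y) \<le> e"
  shows "norm ((\<Sum>(x, K)\<in>p. f x * increment g (K \<inter> {a..t})) -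
               (\<Sum>(y, J)\<in>q. f y * (g (Sup J) - g (Inf J)))) \<le> e * (v t - v a)"
proof -
  have fin: "finite p" "finite q" using p q by blast+
  have *: "(\<Sum>(x, K)\<in>p. f x * increment g (K \<inter> {a..t})) =
        (\<Sum>(x, K)\<in>p. \<Sum>(y, J)\<in>q. f x * increment g (K \<inter> J))"
  proof (intro sum.cong refl, clarify)
    fix x K assume "(x, K) \<in> p"
    then obtain c d where "K = {c..d}" using tagged_division_intervalE[OF p] by metis
    then show "f x * increment g (K \<inter> {a..t}) = (\<Sum>(y, J)\<in>q. f x * increment g (K \<inter> J))"
      using increment_tagged_division[OF \<open>a \<le> t\<close> q, of g c d]
      by (simp add: case_prod_unfold flip: sum_distrib_left)
  qed
  have **: "(\<Sum>(x, K)\<in>p. increment h (K \<inter> J)) = h (Sup J) - h (Inf J)"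
    if J: "(y, J) \<in> q" for y J and h :: "real \<Rightarrow> 'b::real_normed_vector"
  proof -
    obtain c d where cd: "J = {c..d}" "a \<le> c" "c \<le> d" "d \<le> b"
      using tagged_division_intervalE[OF q J] \<open>t \<le> b\<close> by (metis order_trans)
    with increment_tagged_division[OF _ p, of h c d] show ?thesis
      by (simp add: Int_commute increment_def Int_absorb2)
  qed
  have "(\<Sum>(y, J)\<in>q. f y * (g (Sup J) - g (Inf J))) =
        (\<Sum>(y, J)\<in>q. \<Sum>(x, K)\<in>p. f y * increment g (K \<inter> J))"
  proof (intro sum.cong refl, clarify)
    fix y J assume "(y, J) \<in> q"
    from **[OF this, of g]
    show "f y * (g (Sup J) - g (Inf J)) = (\<Sum>(x, K)\<in>p. f y * increment g (K \<inter> J))"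
      by (simp add: case_prod_unfold flip: sum_distrib_left)
  qed
  also have "\<dots> = (\<Sum>(x, K)\<in>p. \<Sum>(y, J)\<in>q. f y * increment g (K \<inter> J))"
    unfolding case_prod_unfold by (rule sum.swap)
  finally have "norm ((\<Sum>(x, K)\<in>p. f x * increment g (K \<inter> {a..t})) -
               (\<Sum>(y, J)\<in>q. f y * (g (Sup J) - g (Inf J)))) =
      norm (\<Sum>(x, K)\<in>p. \<Sum>(y, J)\<in>q. (f x - f y) * increment g (K \<inter> J))"
    unfolding * by (simp add: case_prod_unfold algebra_simps flip: sum_subtractf)
  also have "\<dots> \<le> (\<Sum>(x, K)\<in>p. \<Sum>(y, J)\<in>q. e * increment v (K \<inter> J))"
  proof (rule sum_norm_le, clarify, rule sum_norm_le, clarify)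
    fix x K y J assume x: "(x, K) \<in> p" and y: "(y, J) \<in> q"
    obtain c d where K: "K = {c..d}" "a \<le> c" "c \<le> d" "d \<le> b"
      using tagged_division_intervalE[OF p x] by (metis order_trans)
    obtain u w where J: "J = {u..w}" "u \<le> w"
      using tagged_division_intervalE[OF q y] by (metis order_trans)
    show "norm ((f x - f y) * increment g (K \<inter> J)) \<le> e * increment v (K \<inter> J)"
    proof (cases "K \<inter> J = {}")
      case False
      have "norm (increment g (K \<inter> J)) \<le> increment v (K \<inter> J)"
        unfolding K J by (rule norm_increment_le[OF v]) (use K J in auto)
      then show ?thesis
        using close[OF x y False] by (simp add: norm_mult mult_mono')
    qed (simp add: increment_def)
  qed
  also have "\<dots> = (\<Sum>(y, J)\<in>q. \<Sum>(x, K)\<in>p. e * increment v (K \<inter> J))"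
    unfolding case_prod_unfold by (rule sum.swap)
  also have "\<dots> = (\<Sum>(y, J)\<in>q. e * (v (Sup J) - v (Inf J)))"
  proof (intro sum.cong refl, clarify)
    fix y J assume "(y, J) \<in> q"
    from **[OF this, of v]
    show "(\<Sum>(x, K)\<in>p. e * increment v (K \<inter> J)) = e * (v (Sup J) - v (Inf J))"
      by (simp add: case_prod_unfold flip: sum_distrib_left)
  qed
  also have "\<dots> = e * (v t - v a)"
    using additive_tagged_division_1[OF \<open>a \<le> t\<close> q, of v]
    by (simp add: case_prod_unfold flip: sum_distrib_left)
  finally show ?thesis .
qed

definition mesh_division :: "real \<Rightarrow> real \<Rightarrow> real \<Rightarrow> (real \<times> real set) set \<Rightarrow> bool" where
  "mesh_division \<delta> a b p \<longleftrightarrow> p tagged_division_of {a..b} \<and> (\<forall>(x, K)\<in>p. Sup K - Inf K < \<delta>)"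

lemma mesh_division_exists:
  assumes "\<delta> > 0"
  obtains p where "mesh_division \<delta> a b p"
proof -
  have "gauge (\<lambda>x::real. ball x (\<delta>/3))" using assms by (auto intro: gauge_ball)
  then obtain p where p: "p tagged_division_of {a..b}" "(\<lambda>x. ball x (\<delta>/3)) fine p"
    by (rule fine_division_exists_real)
  have "Sup K - Inf K < \<delta>" if K: "(x, K) \<in> p" for x K
  proof -
    obtain c d where "K = {c..d}" "c \<le> x" "x \<le> d"
      using tagged_division_intervalE[OF p(1) K] by metis
    moreover have "K \<subseteq> ball x (\<delta>/3)" using p(2) K by (auto simp: fine_def)
    ultimately have "c \<in> ball x (\<delta>/3)" "d \<in> ball x (\<delta>/3)"
      by (simp_all only: subset_iff) auto
    then show ?thesis
      using \<open>K = {c..d}\<close> \<open>c \<le> x\<close> \<open>x \<le> d\<close> assms by (simp add: dist_real_def)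
  qed
  then show ?thesis using p by (intro that[of p]) (auto simp: mesh_division_def)
qed

lemma mesh_division_mono: "\<lbrakk>mesh_division \<delta> a b p; \<delta> \<le> \<delta>'\<rbrakk> \<Longrightarrow> mesh_division \<delta>' a b p"
  by (fastforce simp: mesh_division_def)

lemma mesh_division_minD:
  assumes "mesh_division (min \<delta> \<delta>') a b p"
  shows "mesh_division \<delta> a b p" "mesh_division \<delta>' a b p"
  using assms by (auto elim: mesh_division_mono)

lemma mesh_division_tags_close:
  assumes p: "mesh_division \<delta> a b p" "(x, K) \<in> p" and q: "mesh_division \<delta> a' b' q" "(y, J) \<in> q"
    and "K \<inter> J \<noteq> {}"
  shows "\<bar>x - y\<bar> < 2 * \<delta>"
proof -
  have "p tagged_division_of {a..b}" "q tagged_division_of {a'..b'}"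
    using p q by (auto simp: mesh_division_def)
  then obtain c d u w where "K = {c..d}" "c \<le> x" "x \<le> d" "J = {u..w}" "u \<le> y" "y \<le> w"
    using p q by (metis tagged_division_intervalE)
  moreover from this have "d - c < \<delta>" "w - u < \<delta>"
    using p q by (auto simp: mesh_division_def)
  moreover have "max c u \<le> min d w"
    using \<open>K \<inter> J \<noteq> {}\<close> \<open>K = {c..d}\<close> \<open>J = {u..w}\<close> by auto
  ultimately show ?thesis by auto
qed

lemma has_rs_integral_mesh:
  "has_rs_integral a b f g I \<longleftrightarrow>
     (\<forall>e>0. \<exists>\<delta>>0. \<forall>p. mesh_division \<delta> a b p \<longrightarrow>
        norm ((\<Sum>(x, K)\<in>p. f x * (g (Sup K) - g (Inf K))) - I) < e)"
  by (simp add: has_rs_integral_def mesh_division_def)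

lemma has_rs_integralE:
  assumes "has_rs_integral a b f g I" "e > 0"
  obtains \<delta> where "\<delta> > 0"
    "\<And>p. mesh_division \<delta> a b p \<Longrightarrow> norm ((\<Sum>(x, K)\<in>p. f x * (g (Sup K) - g (Inf K))) - I) < e"
  using assms unfolding has_rs_integral_mesh by blast

lemma has_rs_integral_unique:
  assumes "has_rs_integral a b f g I" "has_rs_integral a b f g J"
  shows "I = J"
proof (rule ccontr)
  assume "I \<noteq> J"
  define e where "e = norm (I - J) / 2"
  have "e > 0" using \<open>I \<noteq> J\<close> by (simp add: e_def)
  obtain \<delta>1 where 1: "\<delta>1 > 0" "\<And>p. mesh_division \<delta>1 a b p \<Longrightarrow>
      norm ((\<Sum>(x, K)\<in>p. f x * (g (Sup K) - g (Inf K))) - I) < e"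
    by (rule has_rs_integralE[OF assms(1) \<open>e > 0\<close>]) blast
  obtain \<delta>2 where 2: "\<delta>2 > 0" "\<And>p. mesh_division \<delta>2 a b p \<Longrightarrow>
      norm ((\<Sum>(x, K)\<in>p. f x * (g (Sup K) - g (Inf K))) - J) < e"
    by (rule has_rs_integralE[OF assms(2) \<open>e > 0\<close>]) blast
  obtain p where p: "mesh_division (min \<delta>1 \<delta>2) a b p"
    using mesh_division_exists[of "min \<delta>1 \<delta>2"] 1 2 by auto
  define s where "s = (\<Sum>(x, K)\<in>p. f x * (g (Sup K) - g (Inf K)))"
  have "norm (s - I) < e" "norm (s - J) < e"
    using 1(2) 2(2) mesh_division_minD[OF p] by (simp_all add: s_def)
  moreover have "norm (I - J) \<le> norm (s - I) + norm (s - J)"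
    using norm_triangle_ineq4[of "s - J" "s - I"] by simp
  ultimately show False by (simp add: e_def)
qed

lemma rs_integral_unique: "has_rs_integral a b f g I \<Longrightarrow> rs_integral a b f g = I"
  unfolding rs_integral_def by (rule the_equality) (auto dest: has_rs_integral_unique)

lemma uniform_modulus:
  fixes f :: "real \<Rightarrow> 'a::real_normed_vector"
  assumes "continuous_on {a..b} f" "e > 0"
  obtains \<delta> where "\<delta> > 0"
    "\<And>x y. \<lbrakk>x \<in> {a..b}; y \<in> {a..b}; \<bar>x - y\<bar> < 2 * \<delta>\<rbrakk> \<Longrightarrow> norm (f x - f y) \<le> e"
proof -
  have "uniformly_continuous_on {a..b} f"
    using assms(1) by (intro compact_uniformly_continuous) auto
  then obtain \<delta> where "\<delta> > 0" "\<And>x y. \<lbrakk>x \<in> {a..b}; y \<in> {a..b}; \<bar>x - y\<bar> < \<delta>\<rbrakk> \<Longrightarrow> norm (f x - f y) < e"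
    using \<open>e > 0\<close> unfolding uniformly_continuous_on_def dist_norm real_norm_def by metis
  then show ?thesis
    by (intro that[of "\<delta> / 2"]) (auto intro: less_imp_le)
qed

text \<open>
  The sums along any sequence of divisions with mesh tending to zero form a Cauchy sequence, since
  \<open>rs_sums_close\<close> bounds the difference of two fine sums by the modulus of continuity of \<open>f\<close> times the
  variation.
\<close>
lemma has_rs_integral_exists:
  assumes v: "variation_majorant a b g v" and "a \<le> b" and f: "continuous_on {a..b} f"
  shows "has_rs_integral a b f g (rs_integral a b f g)"
proof -
  define S where "S p = (\<Sum>(x, K)\<in>p. f x * (g (Sup K) - g (Inf K)))" for p :: "(real \<times> real set) set"
  define V where "V = v b - v a"
  have "V \<ge> 0"
    using variation_majorant_mono[OF v _ \<open>a \<le> b\<close>] by (simp add: V_def)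
  have cauchy: "\<exists>\<delta>>0. \<forall>p q. mesh_division \<delta> a b p \<longrightarrow> mesh_division \<delta> a b q \<longrightarrow> norm (S p - S q) < e"
    if "e > 0" for e
  proof -
    have "e / (V + 1) > 0" using \<open>V \<ge> 0\<close> that by simp
    then obtain \<delta> where \<delta>: "\<delta> > 0" "\<And>x y. \<lbrakk>x \<in> {a..b}; y \<in> {a..b}; \<bar>x - y\<bar> < 2 * \<delta>\<rbrakk>
        \<Longrightarrow> norm (f x - f y) \<le> e / (V + 1)"
      using uniform_modulus[OF f] by metis
    have "norm (S p - S q) < e" if p: "mesh_division \<delta> a b p" and q: "mesh_division \<delta> a b q" for p q
    proof -
      have pq: "p tagged_division_of {a..b}" "q tagged_division_of {a..b}"
        using p q by (auto simp: mesh_division_def)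
      have "S p = (\<Sum>(x, K)\<in>p. f x * increment g (K \<inter> {a..b}))"
        unfolding S_def
      proof (intro sum.cong refl, clarify)
        fix x K assume "(x, K) \<in> p"
        then have "K \<inter> {a..b} = K" "K \<noteq> {}" using pq(1) by blast+
        then show "f x * (g (Sup K) - g (Inf K)) = f x * increment g (K \<inter> {a..b})"
          by (simp add: increment_def)
      qed
      moreover have "norm ((\<Sum>(x, K)\<in>p. f x * increment g (K \<inter> {a..b})) - S q)
          \<le> e / (V + 1) * (v b - v a)"
        unfolding S_def
      proof (rule rs_sums_close[OF v \<open>a \<le> b\<close> order_refl pq])
        fix x K y J assume *: "(x, K) \<in> p" "(y, J) \<in> q" "K \<inter> J \<noteq> {}"
        then have "x \<in> {a..b}" "y \<in> {a..b}" using pq by blast+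
        then show "norm (f x - f y) \<le> e / (V + 1)"
          using \<delta> mesh_division_tags_close[OF p _ q] * by blast
      qed
      moreover have "e / (V + 1) * (v b - v a) < e"
        using \<open>V \<ge> 0\<close> \<open>e > 0\<close> by (simp add: V_def[symmetric] field_simps)
      ultimately show ?thesis by simp
    qed
    with \<delta> show ?thesis by blast
  qed
  have "\<exists>p. mesh_division (inverse (real (Suc n))) a b p" for n
    by (rule mesh_division_exists[of "inverse (real (Suc n))" a b]) auto
  then obtain P where P: "\<And>n. mesh_division (inverse (real (Suc n))) a b (P n)" by metis
  have small: "\<exists>N. \<forall>n\<ge>N. mesh_division \<delta> a b (P n)" if "\<delta> > 0" for \<delta>
  proof -
    obtain N where N: "inverse (real (Suc N)) < \<delta>" using reals_Archimedean[OF \<open>\<delta> > 0\<close>] by auto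
    have "mesh_division \<delta> a b (P n)" if "n \<ge> N" for n
    proof (rule mesh_division_mono[OF P])
      have "inverse (real (Suc n)) \<le> inverse (real (Suc N))"
        using that by (simp add: field_simps)
      with N show "inverse (real (Suc n)) \<le> \<delta>" by linarith
    qed
    then show ?thesis by blast
  qed
  have "Cauchy (\<lambda>n. S (P n))"
    unfolding Cauchy_def dist_norm by (meson cauchy small)
  then obtain I where I: "(\<lambda>n. S (P n)) \<longlonglongrightarrow> I"
    using Cauchy_convergent_iff convergent_def by metis
  have "has_rs_integral a b f g I"
    unfolding has_rs_integral_mesh S_def[symmetric]
  proof (intro allI impI)
    fix e :: real assume "e > 0"
    then obtain \<delta> where \<delta>: "\<delta> > 0"
      "\<And>p q. \<lbrakk>mesh_division \<delta> a b p; mesh_division \<delta> a b q\<rbrakk> \<Longrightarrow> norm (S p - S q) < e / 2"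
      using cauchy[of "e / 2"] by auto
    obtain N1 where N1: "\<And>n. n \<ge> N1 \<Longrightarrow> mesh_division \<delta> a b (P n)" using small[OF \<delta>(1)] by auto
    obtain N2 where N2: "\<And>n. n \<ge> N2 \<Longrightarrow> norm (S (P n) - I) < e / 2"
      using I \<open>e > 0\<close> unfolding LIMSEQ_def dist_norm by (meson half_gt_zero)
    have "norm (S p - I) < e" if "mesh_division \<delta> a b p" for p
      using norm_triangle_lt[of "S p - S (P (max N1 N2))" "S (P (max N1 N2)) - I" e]
        \<delta>(2)[OF that N1[of "max N1 N2"]] N2[of "max N1 N2"] by simp
    with \<delta>(1) show "\<exists>\<delta>>0. \<forall>p. mesh_division \<delta> a b p \<longrightarrow> norm (S p - I) < e" by blast
  qed
  then show ?thesis by (simp add: rs_integral_unique)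
qed

text \<open>
  The bound depends on \<open>t\<close> only through \<open>v t - v a \<le> v b - v a\<close>, which is the uniformity needed for
  the exchange of integrals.
\<close>
lemma rs_sum_rs_integral_close:
  fixes f g :: "real \<Rightarrow> complex"
  assumes v: "variation_majorant a b g v" and "a \<le> t" "t \<le> b" and f: "continuous_on {a..b} f"
    and \<delta>: "\<And>x y. \<lbrakk>x \<in> {a..b}; y \<in> {a..b}; \<bar>x - y\<bar> < 2 * \<delta>\<rbrakk> \<Longrightarrow> norm (f x - f y) \<le> e"
    and p: "mesh_division \<delta> a b p" and "\<delta> > 0"
  shows "norm ((\<Sum>(x, K)\<in>p. f x * increment g (K \<inter> {a..t})) - rs_integral a t f g) \<le> e * (v t - v a)"
proof (rule field_le_epsilon)
  fix \<epsilon> :: real assume "\<epsilon> > 0"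
  let ?S = "\<Sum>(x, K)\<in>p. f x * increment g (K \<inter> {a..t})"
  have I: "has_rs_integral a t f g (rs_integral a t f g)"
    using assms by (intro has_rs_integral_exists[OF variation_majorant_subinterval[OF v \<open>t \<le> b\<close>]])
      (auto intro: continuous_on_subset)
  obtain \<delta>' where \<delta>': "\<delta>' > 0" "\<And>q. mesh_division \<delta>' a t q \<Longrightarrow>
      norm ((\<Sum>(x, K)\<in>q. f x * (g (Sup K) - g (Inf K))) - rs_integral a t f g) < \<epsilon>"
    by (rule has_rs_integralE[OF I \<open>\<epsilon> > 0\<close>]) blast
  obtain q where q: "mesh_division (min \<delta> \<delta>') a t q"
    using mesh_division_exists[of "min \<delta> \<delta>'"] \<delta>' \<open>\<delta> > 0\<close> by auto
  have q1: "mesh_division \<delta> a t q" and q2: "mesh_division \<delta>' a t q"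
    by (rule mesh_division_minD[OF q])+
  let ?Q = "\<Sum>(x, K)\<in>q. f x * (g (Sup K) - g (Inf K))"
  have pq: "p tagged_division_of {a..b}" "q tagged_division_of {a..t}"
    using p q by (auto simp: mesh_division_def)
  have "norm (?S - ?Q) \<le> e * (v t - v a)"
  proof (rule rs_sums_close[OF v \<open>a \<le> t\<close> \<open>t \<le> b\<close> pq])
    fix x K y J assume *: "(x, K) \<in> p" "(y, J) \<in> q" "K \<inter> J \<noteq> {}"
    then have "x \<in> {a..b}" "y \<in> {a..t}" using pq by blast+
    then show "norm (f x - f y) \<le> e"
      using \<delta> mesh_division_tags_close[OF p _ q1] * \<open>t \<le> b\<close> by auto
  qed
  moreover have "norm (?Q - rs_integral a t f g) < \<epsilon>" using \<delta>' q2 by blast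
  ultimately show "norm (?S - rs_integral a t f g) \<le> e * (v t - v a) + \<epsilon>"
    using norm_triangle_ineq[of "?S - ?Q" "?Q - rs_integral a t f g"] by simp
qed

lemma rs_integral_cong:
  assumes "\<And>x. x \<in> {a..b} \<Longrightarrow> f x = f' x"
  shows "rs_integral a b f g = rs_integral a b f' g"
proof -
  have "(\<Sum>(x, K)\<in>p. f x * (g (Sup K) - g (Inf K))) = (\<Sum>(x, K)\<in>p. f' x * (g (Sup K) - g (Inf K)))"
    if "p tagged_division_of {a..b}" for p
  proof (intro sum.cong refl, clarify)
    fix x K assume "(x, K) \<in> p"
    then have "x \<in> {a..b}" using that by blast
    then show "f x * (g (Sup K) - g (Inf K)) = f' x * (g (Sup K) - g (Inf K))"
      using assms by simp
  qed
  then have "has_rs_integral a b f g I = has_rs_integral a b f' g I" for I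
    unfolding has_rs_integral_mesh mesh_division_def by (simp cong: conj_cong)
  then show ?thesis by (simp add: rs_integral_def)
qed

lemma norm_rs_integral_le:
  fixes f g :: "real \<Rightarrow> complex"
  assumes v: "variation_majorant a b g v" and "a \<le> b" and f: "continuous_on {a..b} f"
    and M: "\<And>x. x \<in> {a..b} \<Longrightarrow> norm (f x) \<le> M"
  shows "norm (rs_integral a b f g) \<le> M * (v b - v a)"
proof (rule field_le_epsilon)
  fix \<epsilon> :: real assume "\<epsilon> > 0"
  obtain \<delta> where \<delta>: "\<delta> > 0" "\<And>q. mesh_division \<delta> a b q \<Longrightarrow>
      norm ((\<Sum>(x, K)\<in>q. f x * (g (Sup K) - g (Inf K))) - rs_integral a b f g) < \<epsilon>"
    by (rule has_rs_integralE[OF has_rs_integral_exists[OF v \<open>a \<le> b\<close> f] \<open>\<epsilon> > 0\<close>]) blast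
  obtain p where p: "mesh_division \<delta> a b p" using mesh_division_exists[OF \<delta>(1)] by metis
  then have tp: "p tagged_division_of {a..b}" by (simp add: mesh_division_def)
  have "norm (\<Sum>(x, K)\<in>p. f x * (g (Sup K) - g (Inf K))) \<le> (\<Sum>(x, K)\<in>p. M * (v (Sup K) - v (Inf K)))"
  proof (rule sum_norm_le, clarify)
    fix x K assume x: "(x, K) \<in> p"
    then obtain c d where K: "K = {c..d}" "a \<le> c" "c \<le> x" "x \<le> d" "d \<le> b"
      using tagged_division_intervalE[OF tp] by metis
    then show "norm (f x * (g (Sup K) - g (Inf K))) \<le> M * (v (Sup K) - v (Inf K))"
      using M[of x] variation_majorantD[OF v, of c d] by (simp add: norm_mult mult_mono')
  qed
  also have "\<dots> = M * (v b - v a)"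
    using additive_tagged_division_1[OF \<open>a \<le> b\<close> tp, of v]
    by (simp add: case_prod_unfold flip: sum_distrib_left)
  finally show "norm (rs_integral a b f g) \<le> M * (v b - v a) + \<epsilon>"
    using \<delta>(2)[OF p] norm_triangle_sub[of "rs_integral a b f g"
        "\<Sum>(x, K)\<in>p. f x * (g (Sup K) - g (Inf K))"] by (simp add: norm_minus_commute)
qed

lemma has_rs_integral_diff:
  assumes "has_rs_integral a b f g I" "has_rs_integral a b f' g I'"
  shows "has_rs_integral a b (\<lambda>x. f x - f' x) g (I - I')"
  unfolding has_rs_integral_mesh
proof (intro allI impI)
  let ?S = "\<lambda>f p. \<Sum>(x, K)\<in>p. f x * (g (Sup K) - g (Inf K))"
  fix e :: real assume "e > 0"
  then have "e / 2 > 0" by simp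
  obtain \<delta>1 where 1: "\<delta>1 > 0" "\<And>p. mesh_division \<delta>1 a b p \<Longrightarrow> norm (?S f p - I) < e / 2"
    by (rule has_rs_integralE[OF assms(1) \<open>e / 2 > 0\<close>]) blast
  obtain \<delta>2 where 2: "\<delta>2 > 0" "\<And>p. mesh_division \<delta>2 a b p \<Longrightarrow> norm (?S f' p - I') < e / 2"
    by (rule has_rs_integralE[OF assms(2) \<open>e / 2 > 0\<close>]) blast
  have "norm (?S (\<lambda>x. f x - f' x) p - (I - I')) < e" if p: "mesh_division (min \<delta>1 \<delta>2) a b p" for p
  proof -
    have eq: "?S (\<lambda>x. f x - f' x) p = ?S f p - ?S f' p"
      by (simp add: case_prod_unfold algebra_simps sum_subtractf sum.distrib)
    have *: "norm (?S f p - I) < e / 2" "norm (?S f' p - I') < e / 2"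
      using 1(2) 2(2) mesh_division_minD[OF p] by blast+
    have **: "norm (u - u' - (I - I')) < e" if "norm (u - I) < e / 2" "norm (u' - I') < e / 2" for u u'
    proof -
      have eq: "u - u' - (I - I') = (u - I) - (u' - I')" by simp
      show ?thesis
        unfolding eq using norm_triangle_ineq4[of "u - I" "u' - I'"] that by linarith
    qed
    show ?thesis unfolding eq by (rule **[OF *])
  qed
  then show "\<exists>\<delta>>0. \<forall>p. mesh_division \<delta> a b p \<longrightarrow> norm (?S (\<lambda>x. f x - f' x) p - (I - I')) < e"
    using 1(1) 2(1) by (intro exI[of _ "min \<delta>1 \<delta>2"]) auto
qed

lemma has_rs_integral_cmult:
  assumes "has_rs_integral a b f g I"
  shows "has_rs_integral a b (\<lambda>x. c * f x) g (c * I)"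
  unfolding has_rs_integral_mesh
proof (intro allI impI)
  let ?S = "\<lambda>f p. \<Sum>(x, K)\<in>p. f x * (g (Sup K) - g (Inf K))"
  fix e :: real assume "e > 0"
  then have e: "e / (norm c + 1) > 0" by (simp add: add_nonneg_pos)
  obtain \<delta> where \<delta>: "\<delta> > 0" "\<And>p. mesh_division \<delta> a b p \<Longrightarrow> norm (?S f p - I) < e / (norm c + 1)"
    by (rule has_rs_integralE[OF assms e]) blast
  have "norm (?S (\<lambda>x. c * f x) p - c * I) < e" if p: "mesh_division \<delta> a b p" for p
  proof -
    have "?S (\<lambda>x. c * f x) p = c * ?S f p"
      by (simp add: case_prod_unfold sum_distrib_left mult.assoc)
    then have "norm (?S (\<lambda>x. c * f x) p - c * I) = norm c * norm (?S f p - I)"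
      by (simp add: norm_mult flip: right_diff_distrib)
    also have "\<dots> \<le> norm c * (e / (norm c + 1))"
      using \<delta>(2)[OF p] by (intro mult_left_mono) auto
    also have "\<dots> < e"
    proof -
      have "0 < norm c + 1" by (simp add: add_nonneg_pos)
      with \<open>e > 0\<close> show ?thesis by (simp add: field_simps)
    qed
    finally show ?thesis .
  qed
  with \<delta>(1) show "\<exists>\<delta>>0. \<forall>p. mesh_division \<delta> a b p \<longrightarrow> norm (?S (\<lambda>x. c * f x) p - c * I) < e" by blast
qed

section \<open>Exchanging the integrals over a triangle\<close>

text \<open>
  The real and the imaginary part are differences of the monotone functions \<open>v\<close> and \<open>v - Re g\<close>, and
  \<open>v\<close> and \<open>v - Im g\<close>, respectively.
\<close>
lemma borel_measurable_variation_majorant: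
  fixes g :: "real \<Rightarrow> complex"
  assumes v: "variation_majorant a b g v"
  shows "g \<in> borel_measurable (lebesgue_on {a..b})"
proof -
  have mono_meas: "h \<in> borel_measurable (lebesgue_on {a..b})" if "mono_on {a..b} h" for h :: "real \<Rightarrow> real"
    using integrable_mono_on[OF that] by (rule borel_measurable_integrable)
  have part: "(\<lambda>t. L (g t)) \<in> borel_measurable (lebesgue_on {a..b})"
    if L: "\<And>z w. L z - L w \<le> norm (z - w)" for L :: "complex \<Rightarrow> real"
  proof -
    have "mono_on {a..b} (\<lambda>t. v t - L (g t))"
    proof (rule mono_onI)
      fix s t assume "s \<in> {a..b}" "t \<in> {a..b}" "s \<le> t"
      then have "norm (g t - g s) \<le> v t - v s"
        using variation_majorantD[OF v] by auto
      with L[of "g t" "g s"] show "v s - L (g s) \<le> v t - L (g t)" by linarith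
    qed
    from borel_measurable_diff[OF mono_meas[OF variation_majorant_mono_on[OF v]] mono_meas[OF this]]
    show ?thesis by simp
  qed
  have "(\<lambda>t. Re (g t)) \<in> borel_measurable (lebesgue_on {a..b})"
    by (rule part) (metis complex_Re_le_cmod minus_complex.sel(1))
  moreover have "(\<lambda>t. Im (g t)) \<in> borel_measurable (lebesgue_on {a..b})"
    by (rule part) (metis abs_Im_le_cmod abs_le_D1 minus_complex.sel(2))
  ultimately show ?thesis by (simp add: borel_measurable_complex_iff)
qed

lemma integrable_continuous_mult_bounded_variation:
  fixes f g :: "real \<Rightarrow> complex"
  assumes v: "variation_majorant a b g v" and f: "continuous_on {a..b} f"
  shows "(\<lambda>t. f t * g t) integrable_on {a..b}"
proof -
  obtain M where M: "\<And>t. t \<in> {a..b} \<Longrightarrow> norm (f t) \<le> M"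
    using compact_continuous_image[OF f compact_Icc] compact_imp_bounded bounded_iff by (metis imageI)
  show ?thesis
  proof (rule measurable_bounded_by_integrable_imp_integrable)
    show "(\<lambda>t. f t * g t) \<in> borel_measurable (lebesgue_on {a..b})"
      by (intro borel_measurable_times borel_measurable_variation_majorant[OF v]
          continuous_imp_measurable_on_sets_lebesgue f) simp
    show "(\<lambda>t. M * (norm (g a) + (v b - v a))) integrable_on {a..b}"
      by (intro integrable_continuous_real continuous_intros)
    show "norm (f t * g t) \<le> M * (norm (g a) + (v b - v a))" if t: "t \<in> {a..b}" for t
    proof -
      have "norm (g t) \<le> norm (g a) + norm (g t - g a)" using norm_triangle_sub[of "g t" "g a"] by simp
      also have "norm (g t - g a) \<le> v t - v a" using variation_majorantD[OF v, of a t] t by simp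
      also have "v t \<le> v b" using variation_majorant_mono[OF v, of t b] t by simp
      finally show ?thesis using M[OF t] by (auto simp: norm_mult intro: mult_mono')
    qed
  qed simp
qed

text \<open>
  For a fine tagged division \<open>p\<close>, the sum \<open>S p \<xi>\<close> of the terms \<open>f \<xi> x * increment g (K \<inter> {a..\<xi>})\<close> is uniformly
  close to the inner integral \<open>G \<xi>\<close>. Each term is continuous times of bounded variation in \<open>\<xi>\<close>, hence
  integrable, and so \<open>G\<close> is integrable as a uniform limit. The integral of a term differs from the
  matching term \<open>F x * (g (Sup K) - g (Inf K))\<close> of a Riemann--Stieltjes sum only by what happens for \<open>\<xi>\<close>
  in \<open>K\<close>: before \<open>K\<close> both integrands vanish, and after \<open>K\<close> they agree. This difference is of the order of the
  length of \<open>K\<close> times the variation on \<open>K\<close>, and its sum tends to zero with the mesh.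
\<close>
lemma rs_fubini_triangle:
  fixes f :: "real \<Rightarrow> real \<Rightarrow> complex" and g :: "real \<Rightarrow> complex"
  assumes v: "variation_majorant a b g v" and ab: "a \<le> b"
    and f: "continuous_on ({a..b} \<times> {a..b}) (\<lambda>(\<xi>, \<theta>). f \<xi> \<theta>)"
  obtains I where "((\<lambda>\<xi>. rs_integral a \<xi> (f \<xi>) g) has_integral I) {a..b}"
    and "has_rs_integral a b (\<lambda>\<theta>. integral {\<theta>..b} (\<lambda>\<xi>. f \<xi> \<theta>)) g I"
proof -
  define G where "G = (\<lambda>\<xi>. rs_integral a \<xi> (f \<xi>) g)"
  define F where "F = (\<lambda>\<theta>. integral {\<theta>..b} (\<lambda>\<xi>. f \<xi> \<theta>))"
  define V where "V = v b - v a"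
  have V: "V \<ge> 0" using variation_majorant_mono[OF v _ ab] by (simp add: V_def)
  define S where "S p \<xi> = (\<Sum>(x, K)\<in>p. f \<xi> x * increment g (K \<inter> {a..\<xi>}))" for p \<xi>
  have f1: "continuous_on {a..b} (\<lambda>\<xi>. f \<xi> \<theta>)" if "\<theta> \<in> {a..b}" for \<theta>
    using continuous_on_compose2[OF f, of "{a..b}" "\<lambda>\<xi>. (\<xi>, \<theta>)"] that
    by (force intro: continuous_intros)
  have f2: "continuous_on {a..b} (f \<xi>)" if "\<xi> \<in> {a..b}" for \<xi>
    using continuous_on_compose2[OF f, of "{a..b}" "\<lambda>\<theta>. (\<xi>, \<theta>)"] that
    by (force intro: continuous_intros)
  have cmp: "compact ({a..b} \<times> {a..b})" by (intro compact_Times compact_Icc)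
  obtain M where M: "\<And>\<xi> \<theta>. \<lbrakk>\<xi> \<in> {a..b}; \<theta> \<in> {a..b}\<rbrakk> \<Longrightarrow> norm (f \<xi> \<theta>) \<le> M"
  proof -
    have "bounded ((\<lambda>(\<xi>, \<theta>). f \<xi> \<theta>) ` ({a..b} \<times> {a..b}))"
      using compact_continuous_image[OF f cmp] compact_imp_bounded by blast
    then show ?thesis using that unfolding bounded_iff by force
  qed
  have M0: "M \<ge> 0" using order_trans[OF norm_ge_zero M[of a a]] ab by auto
  have modulus: "\<exists>\<delta>>0. \<forall>\<xi>\<in>{a..b}. \<forall>x\<in>{a..b}. \<forall>y\<in>{a..b}. \<bar>x - y\<bar> < 2 * \<delta> \<longrightarrow> norm (f \<xi> x - f \<xi> y) \<le> e"
    if "e > 0" for e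
  proof -
    have "uniformly_continuous_on ({a..b} \<times> {a..b}) (\<lambda>(\<xi>, \<theta>). f \<xi> \<theta>)"
      by (rule compact_uniformly_continuous[OF f cmp])
    from uniformly_continuous_onE[OF this \<open>e > 0\<close>] obtain d where d: "d > 0"
      "\<And>p q. \<lbrakk>p \<in> {a..b} \<times> {a..b}; q \<in> {a..b} \<times> {a..b}; dist q p < d\<rbrakk>
        \<Longrightarrow> dist (case q of (\<xi>, \<theta>) \<Rightarrow> f \<xi> \<theta>) (case p of (\<xi>, \<theta>) \<Rightarrow> f \<xi> \<theta>) < e"
      by blast
    have "norm (f \<xi> x - f \<xi> y) \<le> e"
      if "\<xi> \<in> {a..b}" "x \<in> {a..b}" "y \<in> {a..b}" "\<bar>x - y\<bar> < 2 * (d / 2)" for \<xi> x y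
      using d(2)[of "(\<xi>, y)" "(\<xi>, x)"] that by (simp add: dist_Pair_Pair dist_norm)
    then show ?thesis using d(1) by (intro exI[of _ "d / 2"]) auto
  qed
  have close: "norm (G \<xi> - S p \<xi>) \<le> e * V"
    if "\<delta> > 0" "mesh_division \<delta> a b p" "\<xi> \<in> {a..b}" "e > 0"
      "\<forall>\<xi>\<in>{a..b}. \<forall>x\<in>{a..b}. \<forall>y\<in>{a..b}. \<bar>x - y\<bar> < 2 * \<delta> \<longrightarrow> norm (f \<xi> x - f \<xi> y) \<le> e" for \<delta> p \<xi> e
  proof -
    have "norm (S p \<xi> - G \<xi>) \<le> e * (v \<xi> - v a)"
      unfolding S_def G_def
      by (rule rs_sum_rs_integral_close[OF v _ _ f2, where \<delta> = \<delta>]) (use that in auto)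
    also have "\<dots> \<le> e * V"
      using variation_majorant_mono[OF v, of \<xi> b] that by (simp add: V_def)
    finally show ?thesis by (simp add: norm_minus_commute)
  qed
  have cell: "(\<lambda>\<xi>. f \<xi> x * increment g (K \<inter> {a..\<xi>})) integrable_on {a..b} \<and>
      norm (integral {a..b} (\<lambda>\<xi>. f \<xi> x * increment g (K \<inter> {a..\<xi>})) - F x * (g (Sup K) - g (Inf K)))
        \<le> M * (v (Sup K) - v (Inf K)) * (Sup K - Inf K)"
    if p: "p tagged_division_of {a..b}" "(x, K) \<in> p" for p x K
  proof -
    obtain c d where K: "K = {c..d}" "a \<le> c" "c \<le> x" "x \<le> d" "d \<le> b"
      using tagged_division_intervalE[OF p] by metis
    then have x: "x \<in> {a..b}" and cd: "c \<le> d" "c \<le> b" by auto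
    have incr: "increment g (K \<inter> {a..\<xi>}) = g (max c (min d \<xi>)) - g c" if "\<xi> \<in> {a..b}" for \<xi>
      using increment_Int_clamp[of c d a \<xi> g] K cd that by (simp add: max_absorb1 min_absorb2)
    have "(\<lambda>\<xi>. f \<xi> x * g (max c (min d \<xi>)) - f \<xi> x * g c) integrable_on {a..b}"
    proof (intro integrable_diff)
      show "(\<lambda>\<xi>. f \<xi> x * g (max c (min d \<xi>))) integrable_on {a..b}"
        using integrable_continuous_mult_bounded_variation[OF variation_majorant_clamp[OF v] f1[OF x], of c d] K cd
        by simp
      show "(\<lambda>\<xi>. f \<xi> x * g c) integrable_on {a..b}"
        by (intro integrable_continuous_real continuous_intros f1[OF x])
    qed
    then have int1: "(\<lambda>\<xi>. f \<xi> x * increment g (K \<inter> {a..\<xi>})) integrable_on {a..b}"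
      by (rule integrable_eq) (simp add: incr right_diff_distrib)
    have "(\<lambda>\<xi>. f \<xi> x) integrable_on {x..b}"
      using f1[OF x] x by (intro integrable_continuous_real) (auto elim: continuous_on_subset)
    then have "((\<lambda>\<xi>. f \<xi> x) has_integral F x) {x..b}"
      by (simp add: F_def integrable_integral)
    then have "((\<lambda>\<xi>. if \<xi> \<in> {x..b} then f \<xi> x else 0) has_integral F x) {a..b}"
      using x by (subst has_integral_restrict) auto
    then have "((\<lambda>\<xi>. (if \<xi> \<in> {x..b} then f \<xi> x else 0) * (g d - g c)) has_integral F x * (g d - g c)) {a..b}"
      by (rule has_integral_mult_left)
    from has_integral_diff[OF integrable_integral[OF int1] this]
    have "((\<lambda>\<xi>. f \<xi> x * increment g (K \<inter> {a..\<xi>}) - (if \<xi> \<in> {x..b} then f \<xi> x else 0) * (g d - g c))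
      has_integral integral {a..b} (\<lambda>\<xi>. f \<xi> x * increment g (K \<inter> {a..\<xi>})) - F x * (g d - g c)) {a..b}"
      (is "(?D has_integral ?E) _") .
    \<comment> \<open>Only the cell itself contributes to the difference of the two integrands.\<close>
    moreover have "?D \<xi> = (if \<xi> \<in> {c..d} then ?D \<xi> else 0)" if "\<xi> \<in> {a..b}" for \<xi>
    proof (cases "\<xi> \<in> {c..d}")
      case False
      then have "\<xi> < c \<or> d < \<xi>" by auto
      then show ?thesis using that K incr[OF that] by auto
    qed simp
    ultimately have "((\<lambda>\<xi>. if \<xi> \<in> {c..d} then ?D \<xi> else 0) has_integral ?E) {a..b}"
      using has_integral_cong[of "{a..b}" ?D "\<lambda>\<xi>. if \<xi> \<in> {c..d} then ?D \<xi> else 0" ?E] by blast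
    then have "(?D has_integral ?E) {c..d}"
      using K by (subst (asm) has_integral_restrict) auto
    then have "norm ?E \<le> M * (v d - v c) * measure lborel (cbox c d)"
    proof (intro has_integral_bound[where f = ?D])
      show "0 \<le> M * (v d - v c)"
        using M0 variation_majorant_mono[OF v _ cd(1)] K by simp
      fix \<xi> assume "\<xi> \<in> cbox c d"
      then have \<xi>: "\<xi> \<in> {a..b}" "c \<le> \<xi>" "\<xi> \<le> d" using K by auto
      show "norm (?D \<xi>) \<le> M * (v d - v c)"
      proof (cases "x \<le> \<xi>")
        case True
        then have "?D \<xi> = f \<xi> x * (g \<xi> - g d)"
          unfolding incr[OF \<xi>(1)] using \<xi> by (simp add: algebra_simps)
        moreover have "norm (g \<xi> - g d) \<le> v d - v \<xi>"
          using variation_majorantD[OF v, of \<xi> d] \<xi> K by (simp add: norm_minus_commute)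
        moreover have "v c \<le> v \<xi>" using variation_majorant_mono[OF v, of c \<xi>] \<xi> K by simp
        ultimately show ?thesis using M[OF \<xi>(1) x] by (simp add: norm_mult mult_mono')
      next
        case False
        then have "?D \<xi> = f \<xi> x * (g \<xi> - g c)"
          using \<xi> incr[OF \<xi>(1)] by simp
        moreover have "norm (g \<xi> - g c) \<le> v \<xi> - v c"
          using variation_majorantD[OF v, of c \<xi>] \<xi> K by simp
        moreover have "v \<xi> \<le> v d" using variation_majorant_mono[OF v, of \<xi> d] \<xi> K by simp
        ultimately show ?thesis using M[OF \<xi>(1) x] by (simp add: norm_mult mult_mono')
      qed
    qed simp
    then show ?thesis using int1 K cd by simp
  qed
  have S_int: "S p integrable_on {a..b}" if p: "p tagged_division_of {a..b}" for p
    unfolding S_def using cell[OF p] p by (intro integrable_sum) (auto simp: case_prod_unfold)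
  have G_int: "G integrable_on {a..b}"
    unfolding box_real[symmetric]
  proof (rule integrable_uniform_limit)
    fix e :: real assume "e > 0"
    then have e': "e / (V + 1) > 0" using V by simp
    then obtain \<delta> where \<delta>: "\<delta> > 0" "\<forall>\<xi>\<in>{a..b}. \<forall>x\<in>{a..b}. \<forall>y\<in>{a..b}. \<bar>x - y\<bar> < 2 * \<delta> \<longrightarrow> norm (f \<xi> x - f \<xi> y) \<le> e / (V + 1)"
      using modulus by blast
    obtain p where p: "mesh_division \<delta> a b p" by (rule mesh_division_exists[OF \<delta>(1)])
    have "e / (V + 1) * V \<le> e" using V \<open>e > 0\<close> by (simp add: field_simps)
    then have "\<forall>x\<in>cbox a b. norm (G x - S p x) \<le> e"
      using close[OF \<delta>(1) p _ e' \<delta>(2)] by force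
    moreover have "S p integrable_on cbox a b" using S_int p by (simp add: mesh_division_def)
    ultimately show "\<exists>h. (\<forall>x\<in>cbox a b. norm (G x - h x) \<le> e) \<and> h integrable_on cbox a b" by blast
  qed
  define I where "I = integral {a..b} G"
  have "has_rs_integral a b F g I"
    unfolding has_rs_integral_mesh
  proof (intro allI impI)
    fix \<epsilon> :: real assume "\<epsilon> > 0"
    \<comment> \<open>Half of \<open>\<epsilon>\<close> pays for replacing \<open>G\<close> by \<open>S p\<close>, half for the cells; adding 1 avoids a zero denominator.\<close>
    define e where "e = \<epsilon> / (2 * (V * (b - a) + 1))"
    have pos: "V * (b - a) + 1 > 0" using V ab by (simp add: add_nonneg_pos)
    then have e: "e > 0" using \<open>\<epsilon> > 0\<close> by (simp add: e_def)
    obtain \<delta>0 where \<delta>0: "\<delta>0 > 0" "\<forall>\<xi>\<in>{a..b}. \<forall>x\<in>{a..b}. \<forall>y\<in>{a..b}. \<bar>x - y\<bar> < 2 * \<delta>0 \<longrightarrow> norm (f \<xi> x - f \<xi> y) \<le> e"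
      using modulus[OF e] by blast
    have MV: "M * V + 1 > 0" using M0 V by (simp add: add_nonneg_pos)
    define \<delta> where "\<delta> = min \<delta>0 (\<epsilon> / (2 * (M * V + 1)))"
    have \<delta>: "\<delta> > 0" using \<delta>0 \<open>\<epsilon> > 0\<close> MV by (simp add: \<delta>_def)
    have "norm ((\<Sum>(x, K)\<in>p. F x * (g (Sup K) - g (Inf K))) - I) < \<epsilon>" if p: "mesh_division \<delta> a b p" for p
    proof -
      have tp: "p tagged_division_of {a..b}" using p by (simp add: mesh_division_def)
      have p0: "mesh_division \<delta>0 a b p" using p unfolding \<delta>_def by (rule mesh_division_minD)
      have "((\<lambda>\<xi>. G \<xi> - S p \<xi>) has_integral (I - integral {a..b} (S p))) (cbox a b)"
        unfolding I_def box_real by (intro has_integral_diff integrable_integral G_int S_int tp)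
      then have "norm (I - integral {a..b} (S p)) \<le> e * V * measure lborel (cbox a b)"
        by (rule has_integral_bound[rotated]) (use e V close[OF \<delta>0(1) p0 _ e \<delta>0(2)] in auto)
      then have 1: "norm (integral {a..b} (S p) - I) \<le> e * (V * (b - a))"
        using ab by (simp add: norm_minus_commute mult.assoc)
      have "integral {a..b} (S p) = (\<Sum>(x, K)\<in>p. integral {a..b} (\<lambda>\<xi>. f \<xi> x * increment g (K \<inter> {a..\<xi>})))"
        unfolding S_def case_prod_unfold
        using cell[OF tp] tp by (intro integral_sum) auto
      then have "norm ((\<Sum>(x, K)\<in>p. F x * (g (Sup K) - g (Inf K))) - integral {a..b} (S p)) =
         norm (\<Sum>(x, K)\<in>p. integral {a..b} (\<lambda>\<xi>. f \<xi> x * increment g (K \<inter> {a..\<xi>})) - F x * (g (Sup K) - g (Inf K)))"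
        by (simp add: case_prod_unfold sum_subtractf norm_minus_commute)
      also have "\<dots> \<le> (\<Sum>(x, K)\<in>p. M * \<delta> * (v (Sup K) - v (Inf K)))"
      proof (rule sum_norm_le, clarify)
        fix x K assume x: "(x, K) \<in> p"
        obtain c d where K: "K = {c..d}" "a \<le> c" "c \<le> x" "x \<le> d" "d \<le> b"
          using tagged_division_intervalE[OF tp x] by metis
        have "v (Inf K) \<le> v (Sup K)" using variation_majorant_mono[OF v, of c d] K by simp
        moreover have "Sup K - Inf K \<le> \<delta>" using p x by (auto simp: mesh_division_def)
        ultimately have "M * (v (Sup K) - v (Inf K)) * (Sup K - Inf K) \<le> M * (v (Sup K) - v (Inf K)) * \<delta>"
          using M0 by (intro mult_left_mono) auto
        then show "norm (integral {a..b} (\<lambda>\<xi>. f \<xi> x * increment g (K \<inter> {a..\<xi>})) - F x * (g (Sup K) - g (Inf K)))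
            \<le> M * \<delta> * (v (Sup K) - v (Inf K))"
          using cell[OF tp x] by (simp add: mult.assoc mult.commute[of \<delta>])
      qed
      also have "\<dots> = M * \<delta> * V"
        using additive_tagged_division_1[OF ab tp, of v]
        by (simp add: V_def case_prod_unfold flip: sum_distrib_left)
      finally have 2: "norm ((\<Sum>(x, K)\<in>p. F x * (g (Sup K) - g (Inf K))) - integral {a..b} (S p)) \<le> \<delta> * (M * V)"
        by (simp add: mult_ac)
      have "e * (V * (b - a)) < e * (V * (b - a) + 1)" using e by simp
      also have "\<dots> = \<epsilon> / 2" using pos by (simp add: e_def field_simps)
      finally have 3: "e * (V * (b - a)) < \<epsilon> / 2" .
      have "\<delta> * (M * V) \<le> \<epsilon> / (2 * (M * V + 1)) * (M * V)"
        using M0 V by (intro mult_right_mono) (auto simp: \<delta>_def)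
      also have "\<dots> \<le> \<epsilon> / 2" using MV \<open>\<epsilon> > 0\<close> by (simp add: field_simps)
      finally have 4: "\<delta> * (M * V) \<le> \<epsilon> / 2" .
      show ?thesis
        using norm_diff_triangle_le[OF 2 1] 3 4 by linarith
    qed
    with \<delta> show "\<exists>\<delta>>0. \<forall>p. mesh_division \<delta> a b p \<longrightarrow> norm ((\<Sum>(x, K)\<in>p. F x * (g (Sup K) - g (Inf K))) - I) < \<epsilon>"
      by blast
  qed
  moreover have "(G has_integral I) {a..b}" using G_int by (simp add: I_def integrable_integral)
  ultimately show ?thesis using that unfolding F_def G_def by blast
qed

section \<open>Existence of solutions of the delay equation\<close>
lemma norm_rs_integral_col_le:
  fixes \<eta> :: "real \<Rightarrow> complex ^ 'n ^ 'n" and \<phi> :: "real \<Rightarrow> complex ^ 'n"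
  assumes v: "\<And>i j. variation_majorant a b (\<lambda>\<theta>. \<eta> \<theta> $ i $ j) v" and "a \<le> b"
    and \<phi>: "continuous_on {a..b} \<phi>" and M: "\<And>\<theta>. \<theta> \<in> {a..b} \<Longrightarrow> norm (\<phi> \<theta>) \<le> M"
  shows "norm (rs_integral_col a b \<eta> \<phi>) \<le> real CARD('n) * real CARD('n) * (v b - v a) * M"
proof -
  have entry: "norm (rs_integral a b (\<lambda>\<theta>. \<phi> \<theta> $ j) (\<lambda>\<theta>. \<eta> \<theta> $ i $ j)) \<le> M * (v b - v a)" for i j
    using M order_trans[OF Finite_Cartesian_Product.norm_nth_le]
    by (intro norm_rs_integral_le[OF v \<open>a \<le> b\<close>] continuous_on_component \<phi>) blast
  have "norm (rs_integral_col a b \<eta> \<phi>) \<le> (\<Sum>i\<in>UNIV. norm (rs_integral_col a b \<eta> \<phi> $ i))"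
    unfolding norm_vec_def by (rule L2_set_le_sum) simp
  also have "\<dots> \<le> (\<Sum>i\<in>(UNIV::'n set). \<Sum>j\<in>(UNIV::'n set). M * (v b - v a))"
    by (intro sum_mono) (simp only: rs_integral_col_def vec_lambda_beta, intro sum_norm_le entry)
  finally show ?thesis by (simp add: mult_ac)
qed

lemma rs_integral_col_diff:
  fixes \<eta> :: "real \<Rightarrow> complex ^ 'n ^ 'n" and \<phi> \<phi>' :: "real \<Rightarrow> complex ^ 'n"
  assumes v: "\<And>i j. variation_majorant a b (\<lambda>\<theta>. \<eta> \<theta> $ i $ j) v" and "a \<le> b"
    and \<phi>: "continuous_on {a..b} \<phi>" "continuous_on {a..b} \<phi>'"
  shows "rs_integral_col a b \<eta> (\<lambda>\<theta>. \<phi> \<theta> - \<phi>' \<theta>) = rs_integral_col a b \<eta> \<phi> - rs_integral_col a b \<eta> \<phi>'"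
proof -
  have "rs_integral a b (\<lambda>\<theta>. \<phi> \<theta> $ j - \<phi>' \<theta> $ j) (\<lambda>\<theta>. \<eta> \<theta> $ i $ j) =
        rs_integral a b (\<lambda>\<theta>. \<phi> \<theta> $ j) (\<lambda>\<theta>. \<eta> \<theta> $ i $ j) - rs_integral a b (\<lambda>\<theta>. \<phi>' \<theta> $ j) (\<lambda>\<theta>. \<eta> \<theta> $ i $ j)" for i j
    by (intro rs_integral_unique has_rs_integral_diff has_rs_integral_exists[OF v \<open>a \<le> b\<close>]
        continuous_on_component \<phi>)
  then show ?thesis
    by (simp add: rs_integral_col_def vec_eq_iff sum_subtractf)
qed

lemma rs_integral_col_cong:
  assumes "\<And>\<theta>. \<theta> \<in> {a..b} \<Longrightarrow> \<phi> \<theta> = \<phi>' \<theta>"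
  shows "rs_integral_col a b \<eta> \<phi> = rs_integral_col a b \<eta> \<phi>'"
  using assms by (auto simp: rs_integral_col_def vec_eq_iff intro!: sum.cong rs_integral_cong)

text \<open>
  The bound on \<open>\<eta>\<close> is required entry by entry, so that the locale can be instantiated with the transpose
  of \<open>\<eta>\<close>, which governs the adjoint equation.
\<close>
locale delay_equation =
  fixes r :: real and \<eta> :: "real \<Rightarrow> complex ^ 'n ^ 'n" and v :: "real \<Rightarrow> real"
  assumes r_pos: "r > 0"
    and majorant: "\<And>i j. variation_majorant (- r) 0 (\<lambda>\<theta>. \<eta> \<theta> $ i $ j) v"
begin

definition op_bound :: real where
  "op_bound = real CARD('n) * real CARD('n) * (v 0 - v (- r))"

lemma op_bound_nonneg: "op_bound \<ge> 0"
  using variation_majorant_mono[OF majorant, of "- r" 0] r_pos by (simp add: op_bound_def)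

lemma norm_fde_op_le:
  assumes "continuous_on {- r..0} \<phi>" "\<And>\<theta>. \<theta> \<in> {- r..0} \<Longrightarrow> norm (\<phi> \<theta>) \<le> M"
  shows "norm (fde_op r \<eta> \<phi>) \<le> op_bound * M"
  unfolding fde_op_def op_bound_def using assms r_pos
  by (intro norm_rs_integral_col_le[OF majorant]) auto

lemma fde_op_diff:
  assumes "continuous_on {- r..0} \<phi>" "continuous_on {- r..0} \<phi>'"
  shows "fde_op r \<eta> (\<lambda>\<theta>. \<phi> \<theta> - \<phi>' \<theta>) = fde_op r \<eta> \<phi> - fde_op r \<eta> \<phi>'"
  unfolding fde_op_def using r_pos by (intro rs_integral_col_diff[OF majorant] assms) simp

lemma continuous_on_segment:
  assumes "continuous_on {- r..} x" "t \<ge> 0"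
  shows "continuous_on {- r..0} (segment x t)"
  unfolding segment_def
  by (rule continuous_on_compose2[OF assms(1)]) (use assms(2) in \<open>auto intro!: continuous_intros\<close>)

lemma continuous_on_fde_op_segment:
  assumes x: "continuous_on {- r..} x"
  shows "continuous_on {0..} (\<lambda>t. fde_op r \<eta> (segment x t))"
  unfolding continuous_on_iff
proof (intro ballI allI impI)
  fix t e :: real assume t: "t \<in> {0..}" and "e > 0"
  then have e': "e / (op_bound + 1) > 0" using op_bound_nonneg by simp
  have "continuous_on {- r..t + 1} x" by (rule continuous_on_subset[OF x]) auto
  then obtain \<delta> where \<delta>: "\<delta> > 0" "\<And>s u. \<lbrakk>s \<in> {- r..t + 1}; u \<in> {- r..t + 1}; \<bar>s - u\<bar> < 2 * \<delta>\<rbrakk>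
      \<Longrightarrow> norm (x s - x u) \<le> e / (op_bound + 1)"
    using uniform_modulus[OF _ e'] by blast
  have "dist (fde_op r \<eta> (segment x s)) (fde_op r \<eta> (segment x t)) < e"
    if s: "s \<in> {0..}" "dist s t < min \<delta> 1" for s
  proof -
    have "fde_op r \<eta> (segment x s) - fde_op r \<eta> (segment x t) =
          fde_op r \<eta> (\<lambda>\<theta>. segment x s \<theta> - segment x t \<theta>)"
      using s t by (intro fde_op_diff[symmetric] continuous_on_segment x) auto
    also have "norm \<dots> \<le> op_bound * (e / (op_bound + 1))"
    proof (rule norm_fde_op_le)
      show "continuous_on {- r..0} (\<lambda>\<theta>. segment x s \<theta> - segment x t \<theta>)"
        using s t by (intro continuous_on_diff continuous_on_segment x) auto
      show "norm (segment x s \<theta> - segment x t \<theta>) \<le> e / (op_bound + 1)" if "\<theta> \<in> {- r..0}" for \<theta>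
        unfolding segment_def using \<delta>(1) that s t by (intro \<delta>(2)) (auto simp: dist_real_def)
    qed
    also have "\<dots> < e" using op_bound_nonneg \<open>e > 0\<close> by (simp add: field_simps)
    finally show ?thesis by (simp add: dist_norm)
  qed
  with \<delta>(1) show "\<exists>d>0. \<forall>s\<in>{0..}. dist s t < d \<longrightarrow>
      dist (fde_op r \<eta> (segment x s)) (fde_op r \<eta> (segment x t)) < e"
    by (intro exI[of _ "min \<delta> 1"]) auto
qed

end

lemma integral_has_vector_derivative_atLeast:
  fixes h :: "real \<Rightarrow> 'a::banach"
  assumes "continuous_on {a..} h" "a \<le> t"
  shows "((\<lambda>u. integral {a..u} h) has_vector_derivative h t) (at t within {a..})"
proof -
  have "continuous_on {a..t + 1} h" by (rule continuous_on_subset[OF assms(1)]) auto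
  then have "((\<lambda>u. integral {a..u} h) has_vector_derivative h t) (at t within {a..t + 1})"
    using assms(2) by (intro integral_has_vector_derivative) auto
  moreover have "at t within {a..} = at t within {a..t + 1}"
    by (rule at_within_nhd[of _ "{..<t + 1}"]) auto
  ultimately show ?thesis by simp
qed

context delay_equation
begin

text \<open>
  The solution is a fixed point of \<open>x \<mapsto> \<phi> + volterra x\<close>. On the whole half-line this map becomes a
  contraction when \<open>x(t)\<close> is measured relative to \<open>exp (rate * t)\<close>: the integral of the exponential gains a
  factor \<open>1 / rate\<close>, and the rate is chosen such that \<open>op_bound / rate \<le> 1/2\<close>. The weight is constant to the
  left of \<open>-r\<close>, which makes it bounded away from zero, so that bounded continuous functions on the
  real line form the space for the fixed point argument.
\<close>
definition rate :: real where "rate = 2 * op_bound + 1"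

definition weight :: "real \<Rightarrow> real" where "weight t = exp (rate * max t (- r))"

lemma rate_pos: "rate > 0" using op_bound_nonneg by (simp add: rate_def)

lemma weight_pos: "weight t > 0" by (simp add: weight_def)

lemma continuous_on_weight: "continuous_on S weight"
  unfolding weight_def by (intro continuous_intros)

text \<open>
  The cut-off \<open>max 0 t\<close> makes this vanish on the initial interval, where the solution has to agree with
  \<open>\<phi>\<close>.
\<close>
definition volterra :: "(real \<Rightarrow> complex ^ 'n) \<Rightarrow> real \<Rightarrow> complex ^ 'n" where
  "volterra x t = integral {0..max 0 t} (\<lambda>s. fde_op r \<eta> (segment x s))"

lemma volterra_has_vector_derivative:
  assumes "continuous_on {- r..} x" "t \<ge> 0"
  shows "(volterra x has_vector_derivative fde_op r \<eta> (segment x t)) (at t within {0..})"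
  using integral_has_vector_derivative_atLeast[OF continuous_on_fde_op_segment[OF assms(1)] assms(2)]
  by (rule has_vector_derivative_transform[rotated 2]) (use assms in \<open>auto simp: volterra_def max_def\<close>)

lemma continuous_on_volterra:
  assumes "continuous_on {- r..} x"
  shows "continuous_on S (volterra x)"
proof -
  have "continuous_on {0..} (volterra x)"
    using has_vector_derivative_continuous[OF volterra_has_vector_derivative[OF assms]]
    by (auto simp: continuous_on_eq_continuous_within)
  then have "continuous_on S (\<lambda>t. volterra x (max 0 t))"
    by (rule continuous_on_compose2) (auto intro!: continuous_intros)
  then show ?thesis by (simp add: volterra_def)
qed

lemma volterra_diff:
  assumes "continuous_on {- r..} x" "continuous_on {- r..} y"
  shows "volterra (\<lambda>t. x t - y t) t = volterra x t - volterra y t"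
proof -
  have "fde_op r \<eta> (segment (\<lambda>t. x t - y t) s) = fde_op r \<eta> (segment x s) - fde_op r \<eta> (segment y s)"
    if "s \<in> {0..max 0 t}" for s
    using fde_op_diff[OF continuous_on_segment[OF assms(1)] continuous_on_segment[OF assms(2)], of s s] that
    by (simp add: segment_def)
  then have "volterra (\<lambda>t. x t - y t) t =
      integral {0..max 0 t} (\<lambda>s. fde_op r \<eta> (segment x s) - fde_op r \<eta> (segment y s))"
    unfolding volterra_def by (rule integral_cong)
  also have "\<dots> = volterra x t - volterra y t"
    unfolding volterra_def
    by (intro integral_diff integrable_continuous_real continuous_on_subset[OF continuous_on_fde_op_segment] assms) auto
  finally show ?thesis .
qed

text \<open>
  The delay only looks back, where the weight is smaller; hence the integrand at time \<open>s\<close> is at most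
  \<open>op_bound * m * exp (rate * s)\<close>, and integrating gains the factor \<open>1 / rate\<close>.
\<close>
lemma norm_volterra_le:
  assumes x: "continuous_on {- r..} x" and m: "\<And>t. t \<ge> - r \<Longrightarrow> norm (x t) \<le> weight t * m"
  shows "norm (volterra x t) \<le> weight t * (m / 2)"
proof -
  have "m \<ge> 0"
    using order_trans[OF norm_ge_zero m[of 0]] weight_pos[of 0] r_pos by (simp add: zero_le_mult_iff)
  show ?thesis
  proof (cases "t \<ge> 0")
    case True
    have deriv: "((\<lambda>s. op_bound * m / rate * exp (rate * s)) has_vector_derivative op_bound * m * exp (rate * s))
        (at s within {0..t})" for s
      using rate_pos by (auto intro!: derivative_eq_intros simp flip: has_real_derivative_iff_has_vector_derivative)
    have int: "((\<lambda>s. op_bound * m * exp (rate * s)) has_integral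
        (op_bound * m / rate * exp (rate * t) - op_bound * m / rate * exp (rate * 0))) {0..t}"
      by (rule fundamental_theorem_of_calculus[OF True deriv])
    have "norm (volterra x t) \<le> integral {0..t} (\<lambda>s. op_bound * m * exp (rate * s))"
      unfolding volterra_def max_absorb2[OF True]
    proof (rule Henstock_Kurzweil_Integration.integral_norm_bound_integral)
      show "(\<lambda>s. fde_op r \<eta> (segment x s)) integrable_on {0..t}"
        by (intro integrable_continuous_real continuous_on_subset[OF continuous_on_fde_op_segment] x) auto
      show "(\<lambda>s. op_bound * m * exp (rate * s)) integrable_on {0..t}" using int by blast
      fix s assume s: "s \<in> {0..t}"
      have "norm (fde_op r \<eta> (segment x s)) \<le> op_bound * (exp (rate * s) * m)"
      proof (rule norm_fde_op_le)
        show "continuous_on {- r..0} (segment x s)" using s by (intro continuous_on_segment x) simp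
        fix \<theta> assume \<theta>: "\<theta> \<in> {- r..0}"
        have "norm (segment x s \<theta>) \<le> weight (s + \<theta>) * m"
          unfolding segment_def using s \<theta> by (intro m) simp
        also have "\<dots> \<le> exp (rate * s) * m"
          using \<open>m \<ge> 0\<close> rate_pos s \<theta> by (intro mult_right_mono) (auto simp: weight_def)
        finally show "norm (segment x s \<theta>) \<le> exp (rate * s) * m" .
      qed
      then show "norm (fde_op r \<eta> (segment x s)) \<le> op_bound * m * exp (rate * s)" by (simp add: mult_ac)
    qed
    also have "\<dots> \<le> op_bound * m / rate * exp (rate * t)"
      using integral_unique[OF int] op_bound_nonneg \<open>m \<ge> 0\<close> rate_pos by simp
    also have "op_bound * m / rate \<le> m / 2"
      using op_bound_nonneg \<open>m \<ge> 0\<close> rate_pos by (simp add: rate_def field_simps)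
    finally show ?thesis
      using True r_pos by (simp add: weight_def mult_ac max_def)
  next
    case False
    then show ?thesis using weight_pos[of t] \<open>m \<ge> 0\<close> by (simp add: volterra_def max_def)
  qed
qed

text \<open>
  The unknown of the Banach fixed point theorem is the bounded function \<open>u = x / weight\<close>; \<open>X u\<close> recovers
  \<open>x\<close> from it, and \<open>\<phi>'\<close> is the continuous extension of \<open>\<phi>\<close> by constants.
\<close>
lemma solves_fde_exists:
  assumes \<phi>: "continuous_on {- r..0} \<phi>"
  shows "\<exists>x. solves_fde r \<eta> \<phi> x"
proof -
  define \<phi>' where "\<phi>' t = \<phi> (max (- r) (min 0 t))" for t
  have \<phi>'_cont: "continuous_on UNIV \<phi>'"
    unfolding \<phi>'_def by (rule continuous_on_compose2[OF \<phi>]) (use r_pos in \<open>auto intro!: continuous_intros\<close>)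
  obtain M where M: "\<And>t. t \<in> {- r..0} \<Longrightarrow> norm (\<phi> t) \<le> M"
    using compact_continuous_image[OF \<phi> compact_Icc] compact_imp_bounded bounded_iff by (metis imageI)
  define X where "X u t = weight t *\<^sub>R apply_bcontfun u t" for u :: "real \<Rightarrow>\<^sub>C (complex ^ 'n)" and t
  have X_cont: "continuous_on S (X u)" for S u
    unfolding X_def by (intro continuous_intros continuous_on_weight continuous_on_apply_bcontfun)
  define P where "P u t = inverse (weight t) *\<^sub>R (\<phi>' t + volterra (X u) t)" for u t
  have P_bcontfun: "P u \<in> bcontfun" for u
  proof (rule bcontfun_normI)
    have "\<forall>t\<in>UNIV. weight t \<noteq> 0" by (simp add: weight_def)
    then show "continuous_on UNIV (P u)"
      unfolding P_def
      by (intro continuous_on_scaleR continuous_on_inverse continuous_on_add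
          continuous_on_weight \<phi>'_cont continuous_on_volterra X_cont)
    fix t
    have "norm (volterra (X u) t) \<le> weight t * (norm u / 2)"
      by (rule norm_volterra_le[OF X_cont]) (use weight_pos norm_bounded[of u] in \<open>auto simp: X_def less_imp_le\<close>)
    moreover have "norm (\<phi>' t) \<le> M" unfolding \<phi>'_def using r_pos by (intro M) auto
    ultimately have "norm (\<phi>' t + volterra (X u) t) \<le> M + weight t * (norm u / 2)"
      by (intro norm_triangle_mono)
    then have "inverse (weight t) * norm (\<phi>' t + volterra (X u) t) \<le> inverse (weight t) * (M + weight t * (norm u / 2))"
      using weight_pos[of t] by (intro mult_left_mono) auto
    also have "\<dots> = inverse (weight t) * M + norm u / 2"
      using weight_pos[of t] by (simp add: field_simps)
    also have "\<dots> \<le> exp (rate * r) * M + norm u / 2"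
    proof -
      have "inverse (weight t) \<le> exp (rate * r)"
        using mult_left_mono[of "- max t (- r)" r rate] rate_pos by (simp add: weight_def flip: exp_minus)
      moreover have "M \<ge> 0" using order_trans[OF norm_ge_zero \<open>norm (\<phi>' t) \<le> M\<close>] .
      ultimately show ?thesis by (simp add: mult_right_mono)
    qed
    finally show "norm (P u t) \<le> exp (rate * r) * M + norm u / 2"
      using weight_pos[of t] by (simp add: P_def)
  qed
  have "\<exists>!u. Bcontfun (P u) = u"
  proof (rule banach_fix_type[of "1 / 2"])
    show "\<forall>u u'. dist (Bcontfun (P u)) (Bcontfun (P u')) \<le> 1 / 2 * dist u u'"
    proof (intro allI dist_bound)
      fix u u' t
      have "X u s - X u' s = weight s *\<^sub>R (apply_bcontfun u s - apply_bcontfun u' s)" for s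
        by (simp add: X_def scaleR_diff_right)
      then have "norm (X u s - X u' s) \<le> weight s * dist u u'" for s
        using weight_pos[of s] dist_bounded[of u s u'] by (simp add: dist_norm)
      then have "norm (volterra (\<lambda>t. X u t - X u' t) t) \<le> weight t * (dist u u' / 2)"
        by (intro norm_volterra_le continuous_on_diff X_cont)
      moreover have "P u t - P u' t = inverse (weight t) *\<^sub>R volterra (\<lambda>t. X u t - X u' t) t"
        by (simp add: P_def volterra_diff[OF X_cont X_cont] flip: scaleR_diff_right)
      ultimately have "norm (P u t - P u' t) \<le> dist u u' / 2"
        using weight_pos[of t] by (simp add: field_simps)
      then show "dist (apply_bcontfun (Bcontfun (P u)) t) (apply_bcontfun (Bcontfun (P u')) t) \<le> 1 / 2 * dist u u'"
        by (simp add: Bcontfun_inverse[OF P_bcontfun] dist_norm)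
    qed
  qed auto
  then obtain u where "Bcontfun (P u) = u" by blast
  then have "apply_bcontfun u = P u" using Bcontfun_inverse[OF P_bcontfun] by metis
  then have "X u t = weight t *\<^sub>R P u t" for t by (simp add: X_def)
  then have X_eq: "X u t = \<phi>' t + volterra (X u) t" for t
    using weight_pos[of t] by (simp add: P_def)
  have "solves_fde r \<eta> \<phi> (X u)"
    unfolding solves_fde_def
  proof (intro conjI ballI allI impI X_cont)
    show "X u \<theta> = \<phi> \<theta>" if "\<theta> \<in> {- r..0}" for \<theta>
      using that by (subst X_eq) (simp add: \<phi>'_def volterra_def max_absorb1 min_absorb2)
    fix t :: real assume t: "0 \<le> t"
    have "((\<lambda>t. \<phi> 0 + volterra (X u) t) has_vector_derivative 0 + fde_op r \<eta> (segment (X u) t)) (at t within {0..})"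
      by (intro has_vector_derivative_add has_vector_derivative_const volterra_has_vector_derivative X_cont t)
    then have "((\<lambda>t. \<phi> 0 + volterra (X u) t) has_vector_derivative fde_op r \<eta> (segment (X u) t)) (at t within {0..})"
      by simp
    then show "(X u has_vector_derivative fde_op r \<eta> (segment (X u) t)) (at t within {0..})"
      by (rule has_vector_derivative_transform[rotated 2])
        (use t r_pos in \<open>auto simp: X_eq[of "_"] \<phi>'_def\<close>)
  qed
  then show ?thesis by blast
qed

end

section \<open>The generators differentiate\<close>
lemma has_vector_derivative_at_right_quotient:
  fixes x :: "real \<Rightarrow> 'a::real_normed_vector"
  assumes "(x has_vector_derivative D) (at 0 within {0..})"
  shows "((\<lambda>h. (x h - x 0) /\<^sub>R h) \<longlongrightarrow> D) (at_right 0)"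
proof (rule tendstoI)
  fix e :: real assume "e > 0"
  then have "e / 2 > 0" by simp
  with assms obtain d where d: "d > 0"
    "\<And>h. \<lbrakk>h \<in> {0..}; norm (h - 0) < d\<rbrakk> \<Longrightarrow> norm (x h - x 0 - (h - 0) *\<^sub>R D) \<le> e / 2 * norm (h - 0)"
    unfolding has_vector_derivative_def has_derivative_within_alt by blast
  have "dist ((x h - x 0) /\<^sub>R h) D < e" if h: "0 < h" "h < d" for h
  proof -
    have "(x h - x 0) /\<^sub>R h - D = (x h - x 0 - h *\<^sub>R D) /\<^sub>R h"
      using h by (simp add: scaleR_diff_right)
    then have "dist ((x h - x 0) /\<^sub>R h) D = norm (x h - x 0 - h *\<^sub>R D) / h"
      using h by (simp add: dist_norm divide_inverse mult.commute)
    also have "\<dots> \<le> e / 2"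
      using d(2)[of h] h by (simp add: divide_le_eq)
    finally show ?thesis using \<open>e > 0\<close> by simp
  qed
  with d(1) show "\<forall>\<^sub>F h in at_right 0. dist ((x h - x 0) /\<^sub>R h) D < e"
    unfolding eventually_at_right_field by blast
qed

text \<open>
  For \<open>\<theta> < 0\<close> and small \<open>h\<close> the quotient is one of \<open>\<phi>\<close> itself, so that its limit is a right
  derivative. The left derivative at \<open>\<theta>\<close> comes from the quotient based at \<open>\<theta> - h\<close>: the limit is uniform, and
  \<open>\<zeta> (\<theta> - h)\<close> is close to \<open>\<zeta> \<theta>\<close>. At \<open>\<theta> = 0\<close> the quotient involves values of the solution at positive times, and
  its limit is given by the differential equation.
\<close>
lemma generator_value_along_solution:
  fixes \<eta> :: "real \<Rightarrow> complex ^ 'n ^ 'n"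
  assumes r: "r > 0" and x: "solves_fde r \<eta> \<phi> x"
    and \<zeta>: "continuous_on {- r..0} \<zeta>"
    and lim: "uniform_limit {- r..0} (\<lambda>h \<theta>. (x (h + \<theta>) - \<phi> \<theta>) /\<^sub>R h) \<zeta> (at_right 0)"
  shows "\<And>\<theta>. \<theta> \<in> {- r..0} \<Longrightarrow> (\<phi> has_vector_derivative \<zeta> \<theta>) (at \<theta> within {- r..0})"
    and "\<zeta> 0 = fde_op r \<eta> \<phi>"
proof -
  have x\<phi>: "x \<theta> = \<phi> \<theta>" if "\<theta> \<in> {- r..0}" for \<theta>
    using x that by (simp add: solves_fde_def)
  show "(\<phi> has_vector_derivative \<zeta> \<theta>) (at \<theta> within {- r..0})" if \<theta>: "\<theta> \<in> {- r..0}" for \<theta>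
    unfolding has_vector_derivative_def has_derivative_within_alt
  proof (intro conjI allI impI)
    show "bounded_linear (\<lambda>h. h *\<^sub>R \<zeta> \<theta>)" by (rule bounded_linear_scaleR_left)
    fix e :: real assume "e > 0"
    then have e2: "e / 2 > 0" by simp
    from uniform_limitD[OF lim e2] obtain d1 where d1: "d1 > 0"
      "\<And>h s. \<lbrakk>0 < h; h < d1; s \<in> {- r..0}\<rbrakk> \<Longrightarrow> dist ((x (h + s) - \<phi> s) /\<^sub>R h) (\<zeta> s) < e / 2"
      unfolding eventually_at_right_field by blast
    obtain d2 where d2: "d2 > 0"
      "\<And>s u. \<lbrakk>s \<in> {- r..0}; u \<in> {- r..0}; \<bar>s - u\<bar> < 2 * d2\<rbrakk> \<Longrightarrow> norm (\<zeta> s - \<zeta> u) \<le> e / 2"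
      using uniform_modulus[OF \<zeta> e2] by blast
    have step: "norm (\<phi> t - \<phi> s - (t - s) *\<^sub>R \<zeta> s) \<le> e / 2 * (t - s)"
      if "s \<in> {- r..0}" "t \<in> {- r..0}" "s \<le> t" "t - s < d1" for s t
    proof (cases "s = t")
      case False
      with that have h: "t - s > 0" by simp
      have "\<phi> t - \<phi> s - (t - s) *\<^sub>R \<zeta> s = (t - s) *\<^sub>R ((x ((t - s) + s) - \<phi> s) /\<^sub>R (t - s) - \<zeta> s)"
        using h x\<phi>[OF \<open>t \<in> _\<close>] by (simp add: scaleR_diff_right)
      then have "norm (\<phi> t - \<phi> s - (t - s) *\<^sub>R \<zeta> s) = (t - s) * dist ((x ((t - s) + s) - \<phi> s) /\<^sub>R (t - s)) (\<zeta> s)"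
        using h by (simp only: norm_scaleR dist_norm abs_of_pos)
      also have "\<dots> \<le> (t - s) * (e / 2)"
        using h by (intro mult_left_mono less_imp_le[OF d1(2)[OF h that(4) that(1)]]) simp
      finally show ?thesis by (simp add: mult_ac)
    qed simp
    have "norm (\<phi> t - \<phi> \<theta> - (t - \<theta>) *\<^sub>R \<zeta> \<theta>) \<le> e * norm (t - \<theta>)"
      if t: "t \<in> {- r..0}" "norm (t - \<theta>) < min d1 d2" for t
    proof (cases "\<theta> \<le> t")
      case True
      have "norm (\<phi> t - \<phi> \<theta> - (t - \<theta>) *\<^sub>R \<zeta> \<theta>) \<le> e / 2 * (t - \<theta>)"
        using t True by (intro step \<theta>) auto
      also have "\<dots> \<le> e * norm (t - \<theta>)" using True \<open>e > 0\<close> by (simp add: mult_right_mono)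
      finally show ?thesis .
    next
      case False
      have eq: "\<phi> t - \<phi> \<theta> - (t - \<theta>) *\<^sub>R \<zeta> \<theta> =
          - (\<phi> \<theta> - \<phi> t - (\<theta> - t) *\<^sub>R \<zeta> t) + (\<theta> - t) *\<^sub>R (\<zeta> \<theta> - \<zeta> t)"
        by (simp add: algebra_simps)
      have "norm (\<phi> \<theta> - \<phi> t - (\<theta> - t) *\<^sub>R \<zeta> t) \<le> e / 2 * (\<theta> - t)"
        using t False by (intro step \<theta>) auto
      moreover have "norm ((\<theta> - t) *\<^sub>R (\<zeta> \<theta> - \<zeta> t)) \<le> (\<theta> - t) * (e / 2)"
        using False d2(1) t d2(2)[OF \<theta> t(1)] by (simp del: times_divide_eq_right add: mult_left_mono)
      ultimately have "norm (\<phi> t - \<phi> \<theta> - (t - \<theta>) *\<^sub>R \<zeta> \<theta>) \<le> e / 2 * (\<theta> - t) + (\<theta> - t) * (e / 2)"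
        unfolding eq by (intro norm_triangle_mono) (simp_all only: norm_minus_cancel)
      also have "\<dots> = e * norm (t - \<theta>)" using False by simp
      finally show ?thesis .
    qed
    then show "\<exists>d>0. \<forall>t\<in>{- r..0}. norm (t - \<theta>) < d \<longrightarrow>
        norm (\<phi> t - \<phi> \<theta> - (t - \<theta>) *\<^sub>R \<zeta> \<theta>) \<le> e * norm (t - \<theta>)"
      using d1(1) d2(1) by (intro exI[of _ "min d1 d2"]) auto
  qed
  have "(x has_vector_derivative fde_op r \<eta> (segment x 0)) (at 0 within {0..})"
    using x by (simp add: solves_fde_def)
  then have "((\<lambda>h. (x h - x 0) /\<^sub>R h) \<longlongrightarrow> fde_op r \<eta> (segment x 0)) (at_right 0)"
    by (rule has_vector_derivative_at_right_quotient)
  moreover have "((\<lambda>h. (x h - x 0) /\<^sub>R h) \<longlongrightarrow> \<zeta> 0) (at_right 0)"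
    using tendsto_uniform_limitI[OF lim, of 0] r x\<phi>[of 0] by simp
  ultimately have "\<zeta> 0 = fde_op r \<eta> (segment x 0)"
    using tendsto_unique[OF trivial_limit_at_right_real] by blast
  also have "\<dots> = fde_op r \<eta> \<phi>"
    unfolding fde_op_def by (rule rs_integral_col_cong) (simp add: segment_def x\<phi>)
  finally show "\<zeta> 0 = fde_op r \<eta> \<phi>" .
qed

lemma has_vector_derivative_reflect:
  assumes "(f has_vector_derivative f') (at t within S)"
  shows "((\<lambda>s. f (- s)) has_vector_derivative - f') (at (- t) within uminus ` S)"
proof -
  have "(uminus has_vector_derivative - 1) (at (- t :: real) within uminus ` S)"
    by (auto intro!: derivative_eq_intros simp flip: has_real_derivative_iff_has_vector_derivative)
  from vector_diff_chain_within[OF this, of f f'] assms show ?thesis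
    by (simp add: image_image o_def)
qed

lemma adj_fde_op_eq_fde_op_transpose:
  "adj_fde_op r \<eta> (segment y t) = fde_op r (\<lambda>\<theta>. transpose (\<eta> \<theta>)) (segment (\<lambda>s. y (- s)) (- t))"
  by (simp add: adj_fde_op_def fde_op_def rs_integral_row_def rs_integral_col_def segment_def transpose_def)

text \<open>
  Reversing time and transposing \<open>\<eta>\<close> turns rows into columns and the adjoint equation into a delay
  equation of the original type, so that existence and the description of the generator carry over.
\<close>
lemma solves_adj_fde_iff_solves_fde_transpose:
  "solves_adj_fde r \<eta> \<psi> y \<longleftrightarrow> solves_fde r (\<lambda>\<theta>. transpose (\<eta> \<theta>)) (\<lambda>\<theta>. \<psi> (- \<theta>)) (\<lambda>t. y (- t))"
proof -
  have "continuous_on {..r} y \<longleftrightarrow> continuous_on {- r..} (\<lambda>t. y (- t))"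
  proof
    assume "continuous_on {..r} y"
    then show "continuous_on {- r..} (\<lambda>t. y (- t))"
      by (rule continuous_on_compose2) (auto intro!: continuous_intros)
  next
    assume "continuous_on {- r..} (\<lambda>t. y (- t))"
    then have "continuous_on {..r} (\<lambda>t. y (- (- t)))"
      by (rule continuous_on_compose2) (auto intro!: continuous_intros)
    then show "continuous_on {..r} y" by simp
  qed
  moreover have "(\<forall>\<tau>\<in>{0..r}. y \<tau> = \<psi> \<tau>) \<longleftrightarrow> (\<forall>\<theta>\<in>{- r..0}. y (- \<theta>) = \<psi> (- \<theta>))"
  proof -
    have "{0..r} = uminus ` {- r..0}" by simp
    then show ?thesis by (simp only: ball_simps)
  qed
  moreover have "(\<forall>t\<le>0. (y has_vector_derivative - adj_fde_op r \<eta> (segment y t)) (at t within {..0})) \<longleftrightarrow>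
     (\<forall>t\<ge>0. ((\<lambda>s. y (- s)) has_vector_derivative fde_op r (\<lambda>\<theta>. transpose (\<eta> \<theta>)) (segment (\<lambda>s. y (- s)) t))
        (at t within {0..}))" (is "?A \<longleftrightarrow> ?B")
  proof -
    have "(y has_vector_derivative - D) (at t within {..0}) \<longleftrightarrow>
        ((\<lambda>s. y (- s)) has_vector_derivative D) (at (- t) within {0..})" for t D
      using has_vector_derivative_reflect[of y "- D" t "{..0}"]
        has_vector_derivative_reflect[of "\<lambda>s. y (- s)" D "- t" "{0..}"] by auto
    then have deriv: "(y has_vector_derivative - adj_fde_op r \<eta> (segment y t)) (at t within {..0}) \<longleftrightarrow>
        ((\<lambda>s. y (- s)) has_vector_derivative fde_op r (\<lambda>\<theta>. transpose (\<eta> \<theta>)) (segment (\<lambda>s. y (- s)) (- t)))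
          (at (- t) within {0..})" for t
      unfolding adj_fde_op_eq_fde_op_transpose .
    show ?thesis
    proof
      assume A: ?A
      show ?B
      proof (intro allI impI)
        fix t :: real assume "0 \<le> t"
        with A have "(y has_vector_derivative - adj_fde_op r \<eta> (segment y (- t))) (at (- t) within {..0})" by simp
        then show "((\<lambda>s. y (- s)) has_vector_derivative
            fde_op r (\<lambda>\<theta>. transpose (\<eta> \<theta>)) (segment (\<lambda>s. y (- s)) t)) (at t within {0..})"
          unfolding deriv by simp
      qed
    next
      assume B: ?B
      show ?A unfolding deriv using B by simp
    qed
  qed
  ultimately show ?thesis
    by (simp add: solves_adj_fde_def solves_fde_def)
qed

lemma generator_fde:
  fixes \<eta> :: "real \<Rightarrow> complex ^ 'n ^ 'n"
  assumes r: "r > 0" and v: "\<And>i j. variation_majorant (- r) 0 (\<lambda>\<theta>. \<eta> \<theta> $ i $ j) v"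
    and gen: "has_generator_value {- r..0} (semigroup_T r \<eta>) \<phi> \<zeta>"
  shows "\<And>\<theta>. \<theta> \<in> {- r..0} \<Longrightarrow> (\<phi> has_vector_derivative \<zeta> \<theta>) (at \<theta> within {- r..0})"
    and "\<zeta> 0 = fde_op r \<eta> \<phi>"
proof -
  interpret delay_equation r \<eta> v by unfold_locales (fact r, fact v)
  have \<phi>: "continuous_on {- r..0} \<phi>" and \<zeta>: "continuous_on {- r..0} \<zeta>"
    and lim: "uniform_limit {- r..0} (\<lambda>h \<theta>. (sol_fde r \<eta> \<phi> (h + \<theta>) - \<phi> \<theta>) /\<^sub>R h) \<zeta> (at_right 0)"
    using gen by (simp_all add: has_generator_value_def semigroup_T_def segment_def)
  have "solves_fde r \<eta> \<phi> (sol_fde r \<eta> \<phi>)"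
    unfolding sol_fde_def using solves_fde_exists[OF \<phi>] by (rule someI_ex)
  note * = generator_value_along_solution[OF r this \<zeta> lim]
  show "(\<phi> has_vector_derivative \<zeta> \<theta>) (at \<theta> within {- r..0})" if "\<theta> \<in> {- r..0}" for \<theta>
    using that by (rule *(1))
  show "\<zeta> 0 = fde_op r \<eta> \<phi>" by (rule *(2))
qed

lemma generator_adj_fde:
  fixes \<eta> :: "real \<Rightarrow> complex ^ 'n ^ 'n"
  assumes r: "r > 0" and v: "\<And>i j. variation_majorant (- r) 0 (\<lambda>\<theta>. \<eta> \<theta> $ i $ j) v"
    and gen: "has_generator_value {0..r} (semigroup_Tstar r \<eta>) \<psi> \<kappa>"
  shows "\<And>\<tau>. \<tau> \<in> {0..r} \<Longrightarrow> (\<psi> has_vector_derivative - \<kappa> \<tau>) (at \<tau> within {0..r})"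
    and "\<kappa> 0 = adj_fde_op r \<eta> \<psi>"
proof -
  let ?\<eta>' = "\<lambda>\<theta>. transpose (\<eta> \<theta>)" and ?\<psi>' = "\<lambda>\<theta>. \<psi> (- \<theta>)" and ?\<kappa>' = "\<lambda>\<theta>. \<kappa> (- \<theta>)"
  interpret delay_equation r ?\<eta>' v
    by unfold_locales (fact r, use v in \<open>simp add: transpose_def\<close>)
  define y where "y = sol_adj_fde r \<eta> \<psi>"
  have \<psi>: "continuous_on {0..r} \<psi>" and \<kappa>: "continuous_on {0..r} \<kappa>"
    and lim: "uniform_limit {0..r} (\<lambda>h \<tau>. (y (- h + \<tau>) - \<psi> \<tau>) /\<^sub>R h) \<kappa> (at_right 0)"
    using gen by (simp_all add: has_generator_value_def semigroup_Tstar_def segment_def y_def)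
  have "continuous_on {- r..0} ?\<psi>'"
    by (rule continuous_on_compose2[OF \<psi>]) (auto intro!: continuous_intros)
  then obtain x where "solves_fde r ?\<eta>' ?\<psi>' x" using solves_fde_exists by blast
  then have "solves_adj_fde r \<eta> \<psi> (\<lambda>t. x (- t))"
    by (simp add: solves_adj_fde_iff_solves_fde_transpose)
  then have "solves_adj_fde r \<eta> \<psi> y"
    unfolding y_def sol_adj_fde_def by (rule someI[where P = "solves_adj_fde r \<eta> \<psi>"])
  then have sol: "solves_fde r ?\<eta>' ?\<psi>' (\<lambda>t. y (- t))"
    by (simp add: solves_adj_fde_iff_solves_fde_transpose)
  have \<kappa>': "continuous_on {- r..0} ?\<kappa>'"
    by (rule continuous_on_compose2[OF \<kappa>]) (auto intro!: continuous_intros)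
  have lim': "uniform_limit {- r..0} (\<lambda>h \<theta>. (y (- (h + \<theta>)) - ?\<psi>' \<theta>) /\<^sub>R h) ?\<kappa>' (at_right 0)"
    unfolding uniform_limit_iff
  proof (intro allI impI)
    fix e :: real assume "e > 0"
    from uniform_limitD[OF lim this]
    show "\<forall>\<^sub>F h in at_right 0. \<forall>\<theta>\<in>{- r..0}. dist ((y (- (h + \<theta>)) - ?\<psi>' \<theta>) /\<^sub>R h) (?\<kappa>' \<theta>) < e"
    proof eventually_elim
      case (elim h)
      show ?case
      proof
        fix \<theta> assume "\<theta> \<in> {- r..0}"
        then have "- \<theta> \<in> {0..r}" by simp
        with elim have "dist ((y (- h + - \<theta>) - \<psi> (- \<theta>)) /\<^sub>R h) (\<kappa> (- \<theta>)) < e" by blast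
        then show "dist ((y (- (h + \<theta>)) - ?\<psi>' \<theta>) /\<^sub>R h) (?\<kappa>' \<theta>) < e" by simp
      qed
    qed
  qed
  note * = generator_value_along_solution[OF r sol \<kappa>' lim']
  show "(\<psi> has_vector_derivative - \<kappa> \<tau>) (at \<tau> within {0..r})" if "\<tau> \<in> {0..r}" for \<tau>
    using has_vector_derivative_reflect[OF *(1)[of "- \<tau>"]] that by simp
  show "\<kappa> 0 = adj_fde_op r \<eta> \<psi>"
    using *(2) adj_fde_op_eq_fde_op_transpose[of r \<eta> \<psi> 0] by (simp add: segment_def)
qed

section \<open>Integration by parts for the bilinear form\<close>

text \<open>
  In \<open>rs_fubini_triangle\<close> the integrand lives on the full square. Replacing \<open>\<xi> - \<theta>\<close> by \<open>max 0 (\<xi> - \<theta>)\<close>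
  extends it continuously beyond the triangle, on which it is unchanged.
\<close>
lemma rs_convolution_fubini:
  fixes k w g :: "real \<Rightarrow> complex"
  assumes r: "r > 0" and v: "variation_majorant (- r) 0 g v"
    and k: "continuous_on {0..r} k" and w: "continuous_on {- r..0} w"
  obtains I where
    "((\<lambda>\<xi>. rs_integral (- r) \<xi> (\<lambda>\<theta>. k (\<xi> - \<theta>)) g * w \<xi>) has_integral I) {- r..0}"
    "has_rs_integral (- r) 0 (\<lambda>\<theta>. integral {\<theta>..0} (\<lambda>\<xi>. k (max 0 (\<xi> - \<theta>)) * w \<xi>)) g I"
proof -
  define f where "f \<xi> \<theta> = k (max 0 (\<xi> - \<theta>)) * w \<xi>" for \<xi> \<theta>
  have "continuous_on ({- r..0} \<times> {- r..0}) (\<lambda>p. k (max 0 (fst p - snd p)) * w (fst p))"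
    by (intro continuous_on_mult continuous_on_compose2[OF k] continuous_on_compose2[OF w])
      (use r in \<open>auto intro!: continuous_intros\<close>)
  then have f_cont: "continuous_on ({- r..0} \<times> {- r..0}) (\<lambda>(\<xi>, \<theta>). f \<xi> \<theta>)"
    by (simp add: f_def case_prod_unfold)
  obtain I where I: "((\<lambda>\<xi>. rs_integral (- r) \<xi> (f \<xi>) g) has_integral I) {- r..0}"
    "has_rs_integral (- r) 0 (\<lambda>\<theta>. integral {\<theta>..0} (\<lambda>\<xi>. f \<xi> \<theta>)) g I"
    by (rule rs_fubini_triangle[OF v _ f_cont]) (use r in auto)
  have "rs_integral (- r) \<xi> (f \<xi>) g = rs_integral (- r) \<xi> (\<lambda>\<theta>. k (\<xi> - \<theta>)) g * w \<xi>"
    if \<xi>: "\<xi> \<in> {- r..0}" for \<xi>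
  proof -
    have "continuous_on {- r..\<xi>} (\<lambda>\<theta>. k (\<xi> - \<theta>))"
      by (rule continuous_on_compose2[OF k]) (use \<xi> in \<open>auto intro!: continuous_intros\<close>)
    then have "has_rs_integral (- r) \<xi> (\<lambda>\<theta>. k (\<xi> - \<theta>)) g (rs_integral (- r) \<xi> (\<lambda>\<theta>. k (\<xi> - \<theta>)) g)"
      using \<xi> by (intro has_rs_integral_exists[OF variation_majorant_subinterval[OF v]]) auto
    then have "rs_integral (- r) \<xi> (\<lambda>\<theta>. w \<xi> * k (\<xi> - \<theta>)) g = w \<xi> * rs_integral (- r) \<xi> (\<lambda>\<theta>. k (\<xi> - \<theta>)) g"
      by (intro rs_integral_unique has_rs_integral_cmult)
    moreover have "rs_integral (- r) \<xi> (f \<xi>) g = rs_integral (- r) \<xi> (\<lambda>\<theta>. w \<xi> * k (\<xi> - \<theta>)) g"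
      by (rule rs_integral_cong) (simp add: f_def mult.commute)
    ultimately show ?thesis by (simp add: mult.commute)
  qed
  from has_integral_eq[OF this I(1)]
  have "((\<lambda>\<xi>. rs_integral (- r) \<xi> (\<lambda>\<theta>. k (\<xi> - \<theta>)) g * w \<xi>) has_integral I) {- r..0}" .
  with I(2) show ?thesis using that by (simp add: f_def)
qed

text \<open>
  Both double integrals are exchanged. The inner integrals then combine to that of
  \<open>p (\<xi> - \<theta>) * q' \<xi> - p' (\<xi> - \<theta>) * q \<xi>\<close>, which is the derivative of \<open>p (\<xi> - \<theta>) * q \<xi>\<close> in \<open>\<xi>\<close>, because \<open>-p'\<close>
  is the derivative of \<open>p\<close>. The sign is chosen to match \<open>p' = A\<^sup>* p\<close>.
\<close>
lemma rs_convolution_by_parts: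
  fixes p p' q q' g :: "real \<Rightarrow> complex"
  assumes r: "r > 0" and v: "variation_majorant (- r) 0 g v"
    and p: "\<And>t. t \<in> {0..r} \<Longrightarrow> (p has_vector_derivative - p' t) (at t within {0..r})"
    and q: "\<And>t. t \<in> {- r..0} \<Longrightarrow> (q has_vector_derivative q' t) (at t within {- r..0})"
    and p': "continuous_on {0..r} p'" and q': "continuous_on {- r..0} q'"
  shows "integral {- r..0} (\<lambda>\<xi>. rs_integral (- r) \<xi> (\<lambda>\<theta>. p (\<xi> - \<theta>)) g * q' \<xi>) -
         integral {- r..0} (\<lambda>\<xi>. rs_integral (- r) \<xi> (\<lambda>\<theta>. p' (\<xi> - \<theta>)) g * q \<xi>) =
         rs_integral (- r) 0 (\<lambda>\<theta>. p (- \<theta>)) g * q 0 - p 0 * rs_integral (- r) 0 q g" (is "?lhs = ?rhs")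
proof -
  have cp: "continuous_on {0..r} p"
    using has_vector_derivative_continuous[OF p] by (auto simp: continuous_on_eq_continuous_within)
  have cq: "continuous_on {- r..0} q"
    using has_vector_derivative_continuous[OF q] by (auto simp: continuous_on_eq_continuous_within)
  obtain I1 where I1:
    "((\<lambda>\<xi>. rs_integral (- r) \<xi> (\<lambda>\<theta>. p (\<xi> - \<theta>)) g * q' \<xi>) has_integral I1) {- r..0}"
    "has_rs_integral (- r) 0 (\<lambda>\<theta>. integral {\<theta>..0} (\<lambda>\<xi>. p (max 0 (\<xi> - \<theta>)) * q' \<xi>)) g I1"
    by (rule rs_convolution_fubini[OF r v cp q'])
  obtain I2 where I2:
    "((\<lambda>\<xi>. rs_integral (- r) \<xi> (\<lambda>\<theta>. p' (\<xi> - \<theta>)) g * q \<xi>) has_integral I2) {- r..0}"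
    "has_rs_integral (- r) 0 (\<lambda>\<theta>. integral {\<theta>..0} (\<lambda>\<xi>. p' (max 0 (\<xi> - \<theta>)) * q \<xi>)) g I2"
    by (rule rs_convolution_fubini[OF r v p' cq])
  have inner: "integral {\<theta>..0} (\<lambda>\<xi>. p (max 0 (\<xi> - \<theta>)) * q' \<xi>) - integral {\<theta>..0} (\<lambda>\<xi>. p' (max 0 (\<xi> - \<theta>)) * q \<xi>)
      = q 0 * p (- \<theta>) - p 0 * q \<theta>" if \<theta>: "\<theta> \<in> {- r..0}" for \<theta>
  proof -
    have sub: "{\<theta>..0} \<subseteq> {- r..0}" and shift: "(\<lambda>\<xi>. \<xi> - \<theta>) ` {\<theta>..0} \<subseteq> {0..r}" using \<theta> by auto
    have int: "(\<lambda>\<xi>. k (max 0 (\<xi> - \<theta>)) * w \<xi>) integrable_on {\<theta>..0}"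
      if k: "continuous_on {0..r} k" and w: "continuous_on {- r..0} w" for k w :: "real \<Rightarrow> complex"
      by (intro integrable_continuous_real continuous_on_mult continuous_on_compose2[OF k] continuous_on_subset[OF w sub])
        (use \<theta> in \<open>auto intro!: continuous_intros\<close>)
    have "((\<lambda>\<xi>. p (\<xi> - \<theta>) * q \<xi>) has_vector_derivative
        p (max 0 (\<xi> - \<theta>)) * q' \<xi> - p' (max 0 (\<xi> - \<theta>)) * q \<xi>) (at \<xi> within {\<theta>..0})"
      if \<xi>: "\<xi> \<in> {\<theta>..0}" for \<xi>
    proof -
      have "((\<lambda>\<xi>. \<xi> - \<theta>) has_vector_derivative 1) (at \<xi> within {\<theta>..0})"
        by (auto intro!: derivative_eq_intros simp flip: has_real_derivative_iff_has_vector_derivative)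
      moreover have "(p has_vector_derivative - p' (\<xi> - \<theta>)) (at (\<xi> - \<theta>) within (\<lambda>\<xi>. \<xi> - \<theta>) ` {\<theta>..0})"
        by (rule has_vector_derivative_within_subset[OF p shift]) (use \<xi> \<theta> in auto)
      ultimately have "((\<lambda>\<xi>. p (\<xi> - \<theta>)) has_vector_derivative - p' (\<xi> - \<theta>)) (at \<xi> within {\<theta>..0})"
        using vector_diff_chain_within[of "\<lambda>\<xi>. \<xi> - \<theta>" 1 \<xi> "{\<theta>..0}" p] by (simp add: o_def)
      moreover have "(q has_vector_derivative q' \<xi>) (at \<xi> within {\<theta>..0})"
        by (rule has_vector_derivative_within_subset[OF q sub]) (use \<xi> sub in auto)
      ultimately have "((\<lambda>\<xi>. p (\<xi> - \<theta>) * q \<xi>) has_vector_derivative p (\<xi> - \<theta>) * q' \<xi> + - p' (\<xi> - \<theta>) * q \<xi>)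
          (at \<xi> within {\<theta>..0})"
        by (rule has_vector_derivative_mult)
      then show ?thesis using \<xi> by simp
    qed
    then have "((\<lambda>\<xi>. p (max 0 (\<xi> - \<theta>)) * q' \<xi> - p' (max 0 (\<xi> - \<theta>)) * q \<xi>) has_integral
        p (0 - \<theta>) * q 0 - p (\<theta> - \<theta>) * q \<theta>) {\<theta>..0}"
      using \<theta> by (intro fundamental_theorem_of_calculus) auto
    then have "integral {\<theta>..0} (\<lambda>\<xi>. p (max 0 (\<xi> - \<theta>)) * q' \<xi> - p' (max 0 (\<xi> - \<theta>)) * q \<xi>) =
        q 0 * p (- \<theta>) - p 0 * q \<theta>" by (simp add: integral_unique mult.commute)
    then show ?thesis by (simp add: integral_diff[OF int[OF cp q'] int[OF p' cq]])
  qed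
  have r0: "- r \<le> 0" using r by simp
  have "continuous_on {- r..0} (\<lambda>\<theta>. p (- \<theta>))"
    by (rule continuous_on_compose2[OF cp]) (auto intro!: continuous_intros)
  then have "has_rs_integral (- r) 0 (\<lambda>\<theta>. q 0 * p (- \<theta>) - p 0 * q \<theta>) g
      (q 0 * rs_integral (- r) 0 (\<lambda>\<theta>. p (- \<theta>)) g - p 0 * rs_integral (- r) 0 q g)"
    by (intro has_rs_integral_diff has_rs_integral_cmult has_rs_integral_exists[OF v r0] cq)
  then have "?rhs = rs_integral (- r) 0 (\<lambda>\<theta>. q 0 * p (- \<theta>) - p 0 * q \<theta>) g"
    by (simp add: rs_integral_unique mult.commute)
  also have "\<dots> = rs_integral (- r) 0 (\<lambda>\<theta>. integral {\<theta>..0} (\<lambda>\<xi>. p (max 0 (\<xi> - \<theta>)) * q' \<xi>) -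
      integral {\<theta>..0} (\<lambda>\<xi>. p' (max 0 (\<xi> - \<theta>)) * q \<xi>)) g"
    by (rule rs_integral_cong) (simp add: inner)
  also have "\<dots> = I1 - I2"
    by (intro rs_integral_unique has_rs_integral_diff I1 I2)
  also have "\<dots> = ?lhs"
    using I1(1) I2(1) by (simp add: integral_unique)
  finally show ?thesis ..
qed

lemma bilin_form_expand:
  fixes \<eta> :: "real \<Rightarrow> complex ^ 'n ^ 'n"
  assumes r: "r > 0" and v: "\<And>i j. variation_majorant (- r) 0 (\<lambda>\<theta>. \<eta> \<theta> $ i $ j) v"
    and \<psi>: "continuous_on {0..r} \<psi>" and \<phi>: "continuous_on {- r..0} \<phi>"
  shows "bilin_form r \<eta> \<psi> \<phi> = row_times_col (\<psi> 0) (\<phi> 0) + (\<Sum>i\<in>UNIV. \<Sum>j\<in>UNIV.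
    integral {- r..0} (\<lambda>\<xi>. rs_integral (- r) \<xi> (\<lambda>\<theta>. \<psi> (\<xi> - \<theta>) $ i) (\<lambda>\<theta>. \<eta> \<theta> $ i $ j) * \<phi> \<xi> $ j))"
proof -
  define h where "h i j \<xi> = rs_integral (- r) \<xi> (\<lambda>\<theta>. \<psi> (\<xi> - \<theta>) $ i) (\<lambda>\<theta>. \<eta> \<theta> $ i $ j) * \<phi> \<xi> $ j" for i j \<xi>
  have int: "h i j integrable_on {- r..0}" for i j
    unfolding h_def
    by (rule rs_convolution_fubini[OF r v continuous_on_component[OF \<psi>, of i] continuous_on_component[OF \<phi>, of j]])
      (rule has_integral_integrable)
  have "integral {- r..0} (\<lambda>\<xi>. row_times_col (rs_integral_row (- r) \<xi> (\<lambda>\<theta>. \<psi> (\<xi> - \<theta>)) \<eta>) (\<phi> \<xi>)) =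
      integral {- r..0} (\<lambda>\<xi>. \<Sum>j\<in>UNIV. \<Sum>i\<in>UNIV. h i j \<xi>)"
    by (simp add: row_times_col_def rs_integral_row_def h_def sum_distrib_right)
  also have "\<dots> = (\<Sum>j\<in>UNIV. \<Sum>i\<in>UNIV. integral {- r..0} (h i j))"
    by (simp add: integral_sum integrable_sum int)
  also have "\<dots> = (\<Sum>i\<in>UNIV. \<Sum>j\<in>UNIV. integral {- r..0} (h i j))"
    by (rule sum.swap)
  finally show ?thesis by (simp add: bilin_form_def h_def[abs_def])
qed

theorem corollary3p3:
  fixes r :: real and \<eta> :: "real \<Rightarrow> complex ^ 'n ^ 'n"
    and \<phi> \<psi> :: "real \<Rightarrow> complex ^ 'n"
  assumes "r > 0"
    and "bounded_variation_on (- r) 0 \<eta>"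
    and "\<phi> \<in> generator_domain {- r..0} (semigroup_T r \<eta>)"
    and "\<psi> \<in> generator_domain {0..r} (semigroup_Tstar r \<eta>)"
  shows "bilin_form r \<eta> \<psi> (generator {- r..0} (semigroup_T r \<eta>) \<phi>) =
         bilin_form r \<eta> (generator {0..r} (semigroup_Tstar r \<eta>) \<psi>) \<phi>"
proof -
  define \<zeta> where "\<zeta> = generator {- r..0} (semigroup_T r \<eta>) \<phi>"
  define \<kappa> where "\<kappa> = generator {0..r} (semigroup_Tstar r \<eta>) \<psi>"
  have gen_\<phi>: "has_generator_value {- r..0} (semigroup_T r \<eta>) \<phi> \<zeta>"
    using assms(3) unfolding \<zeta>_def generator_def generator_domain_def mem_Collect_eq by (rule someI_ex)
  have gen_\<psi>: "has_generator_value {0..r} (semigroup_Tstar r \<eta>) \<psi> \<kappa>"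
    using assms(4) unfolding \<kappa>_def generator_def generator_domain_def mem_Collect_eq by (rule someI_ex)
  have cont: "continuous_on {- r..0} \<phi>" "continuous_on {- r..0} \<zeta>"
    "continuous_on {0..r} \<psi>" "continuous_on {0..r} \<kappa>"
    using gen_\<phi> gen_\<psi> by (simp_all add: has_generator_value_def)
  obtain v where "variation_majorant (- r) 0 \<eta> v"
    by (rule bounded_variation_imp_majorant[OF assms(2)])
  then have v: "variation_majorant (- r) 0 (\<lambda>\<theta>. \<eta> \<theta> $ i $ j) v" for i j
    by (rule variation_majorant_entry)
  note A = generator_fde[OF assms(1) v gen_\<phi>]
  note A' = generator_adj_fde[OF assms(1) v gen_\<psi>]
  have comp: "((\<lambda>t. f t $ i) has_vector_derivative D $ i) F"
    if "(f has_vector_derivative D) F" for f :: "real \<Rightarrow> complex ^ 'n" and D i F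
    using bounded_linear.has_vector_derivative[OF bounded_linear_vec_nth that] .
  define a where "a i j = rs_integral (- r) 0 (\<lambda>\<theta>. \<psi> (- \<theta>) $ i) (\<lambda>\<theta>. \<eta> \<theta> $ i $ j)" for i j
  define c where "c i j = rs_integral (- r) 0 (\<lambda>\<theta>. \<phi> \<theta> $ j) (\<lambda>\<theta>. \<eta> \<theta> $ i $ j)" for i j
  define I1 where "I1 i j = integral {- r..0}
    (\<lambda>\<xi>. rs_integral (- r) \<xi> (\<lambda>\<theta>. \<psi> (\<xi> - \<theta>) $ i) (\<lambda>\<theta>. \<eta> \<theta> $ i $ j) * \<zeta> \<xi> $ j)" for i j
  define I2 where "I2 i j = integral {- r..0}
    (\<lambda>\<xi>. rs_integral (- r) \<xi> (\<lambda>\<theta>. \<kappa> (\<xi> - \<theta>) $ i) (\<lambda>\<theta>. \<eta> \<theta> $ i $ j) * \<phi> \<xi> $ j)" for i j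
  \<comment> \<open>Summed over \<open>i\<close> and \<open>j\<close>, the right-hand side is \<open>(L\<^sup>*\<psi>) \<phi>(0) - \<psi>(0) (L\<phi>)\<close>.\<close>
  have parts: "I1 i j - I2 i j = a i j * \<phi> 0 $ j - \<psi> 0 $ i * c i j" for i j
    unfolding I1_def I2_def a_def c_def
    using comp[OF A'(1)] comp[OF A(1)]
    by (intro rs_convolution_by_parts[OF assms(1) v] continuous_on_component cont) simp_all
  have "bilin_form r \<eta> \<psi> \<zeta> - bilin_form r \<eta> \<kappa> \<phi> =
      row_times_col (\<psi> 0) (\<zeta> 0) - row_times_col (\<kappa> 0) (\<phi> 0) + (\<Sum>i\<in>UNIV. \<Sum>j\<in>UNIV. I1 i j - I2 i j)"
    by (simp add: bilin_form_expand[OF assms(1) v] cont I1_def I2_def sum_subtractf)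
  also have "row_times_col (\<psi> 0) (\<zeta> 0) = (\<Sum>i\<in>UNIV. \<Sum>j\<in>UNIV. \<psi> 0 $ i * c i j)"
    by (simp add: row_times_col_def A(2) fde_op_def rs_integral_col_def c_def sum_distrib_left)
  also have "row_times_col (\<kappa> 0) (\<phi> 0) = (\<Sum>j\<in>UNIV. \<Sum>i\<in>UNIV. a i j * \<phi> 0 $ j)"
    by (simp add: row_times_col_def A'(2) adj_fde_op_def rs_integral_row_def a_def sum_distrib_right)
  also have "\<dots> = (\<Sum>i\<in>UNIV. \<Sum>j\<in>UNIV. a i j * \<phi> 0 $ j)"
    by (rule sum.swap)
  finally show ?thesis
    by (simp add: parts sum_subtractf \<zeta>_def \<kappa>_def)
qed

end
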